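(* Let $\mathbb{F}_2=\langle a,b\rangle$ be the free group on two generators. Then there exists a unitary $u\in L(\langle b\rangle)$ such that $uL(\langle a\rangle)u^*$ is not equal to $L(H)$ for any subgroup $H$ of $\mathbb{F}_2$, and $$\mathrm{d}_{\mathrm{KK}}(L(\langle a\rangle),uL(\langle a\rangle)u^* )=1=\mathrm{d}_{\mathrm{MT}}(L(\langle a\rangle),uL(\langle a\rangle)u^* ).$$
   Context: For a countable discrete group $G$, $L(G)=\{\lambda_g:g\in G\}''\subseteq B(\ell^2(G))$ is the group von Neumann algebra, with canonical trace $\tau(x)=\langle x\delta_e,\delta_e\rangle$; for a subgroup $H\le G$, $L(H)$ is viewed as the subalgebra $\{\lambda_h:h\in H\}''$ of $L(G)$. Distances between von Neumann subalgebras $P,Q$ of $(M,\tau)$ (here $M=L(\mathbb{F}_2)$): $\mathrm{d}_{\mathrm{KK}}(P,Q)$ is the Hausdorff distance, in operator norm, between the operator-norm closed unit balls of $P$ and $Q$; $\mathrm{d}_{\mathrm{MT}}(P,Q)$ is the Hausdorff distance between the same unit balls with respect to $\|x\|_\tau=\tau(x^*x)^{1/2}$. *)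

theory Defs
  imports "HOL-Analysis.Analysis" "HOL-Algebra.Generated_Groups"
begin

section \<open>Free groups as groups of reduced words\<close>

text \<open>The letter \<open>(x, True)\<close> stands for the generator \<open>x\<close>, and \<open>(x, False)\<close> for its inverse.\<close>

type_synonym 'x letter = "'x \<times> bool"

definition inv_letter :: "'x letter \<Rightarrow> 'x letter" where
  "inv_letter l = (fst l, \<not> snd l)"

lemma inv_letter_invol [simp]: "inv_letter (inv_letter l) = l"
  by (simp add: inv_letter_def)

lemma inv_letter_eq_iff: "inv_letter k = l \<longleftrightarrow> k = inv_letter l"
  by auto

definition reduced :: "'x letter list \<Rightarrow> bool" where
  "reduced w \<longleftrightarrow> successively (\<lambda>k l. l \<noteq> inv_letter k) w"

text \<open>Left multiplication of a reduced word by one letter, followed by free reduction.\<close>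

fun push :: "'x letter \<Rightarrow> 'x letter list \<Rightarrow> 'x letter list" where
  "push l [] = [l]"
| "push l (k # w) = (if k = inv_letter l then w else l # k # w)"

lemma reduced_Nil [simp]: "reduced []" and reduced_single [simp]: "reduced [l]"
  by (simp_all add: reduced_def)

lemma reduced_Cons2: "reduced (k # l # w) \<longleftrightarrow> l \<noteq> inv_letter k \<and> reduced (l # w)"
  by (simp add: reduced_def)

lemma reduced_ConsD: "reduced (k # w) \<Longrightarrow> reduced w"
  by (cases w) (auto simp: reduced_Cons2)

lemma reduced_push: "reduced w \<Longrightarrow> reduced (push l w)"
  by (cases w) (auto simp: reduced_Cons2 dest: reduced_ConsD)

lemma push_inv_letter:
  assumes "reduced w" shows "push l (push (inv_letter l) w) = w"
proof (cases w)
  case (Cons k v)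
  show ?thesis using assms unfolding Cons by (cases v) (auto simp: reduced_Cons2)
qed simp

lemma push_reduced_Cons: "reduced (l # w) \<Longrightarrow> push l w = l # w"
  by (cases w) (auto simp: reduced_Cons2)

definition word_mult :: "'x letter list \<Rightarrow> 'x letter list \<Rightarrow> 'x letter list" where
  "word_mult v w = foldr push v w"

lemma reduced_word_mult: "reduced w \<Longrightarrow> reduced (word_mult v w)"
  unfolding word_mult_def by (induction v) (auto intro: reduced_push)

lemma word_mult_push:
  assumes "reduced w" shows "word_mult (push l v) w = push l (word_mult v w)"
proof (cases v)
  case (Cons k v')
  then show ?thesis
    using push_inv_letter[OF reduced_word_mult[OF assms], of l v'] by (auto simp: word_mult_def)
qed (simp add: word_mult_def)

lemma word_mult_assoc:
  "reduced w \<Longrightarrow> word_mult (word_mult u v) w = word_mult u (word_mult v w)"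
proof (induction u)
  case (Cons l u)
  have "word_mult (word_mult (l # u) v) w = word_mult (push l (word_mult u v)) w"
    by (simp add: word_mult_def)
  also have "\<dots> = push l (word_mult (word_mult u v) w)"
    by (rule word_mult_push) fact
  also have "\<dots> = word_mult (l # u) (word_mult v w)"
    using Cons by (simp add: word_mult_def)
  finally show ?case .
qed (simp add: word_mult_def)

lemma word_mult_Nil: "reduced w \<Longrightarrow> word_mult w [] = w"
proof (induction w)
  case (Cons l w)
  then show ?case using push_reduced_Cons[OF Cons.prems] reduced_ConsD[OF Cons.prems]
    by (simp add: word_mult_def)
qed (simp add: word_mult_def)

definition word_inv :: "'x letter list \<Rightarrow> 'x letter list" where
  "word_inv w = rev (map inv_letter w)"

lemma reduced_word_inv: "reduced w \<Longrightarrow> reduced (word_inv w)"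
  unfolding reduced_def word_inv_def successively_rev successively_map
  by (erule successively_mono) (metis inv_letter_invol)

lemma word_inv_mult: "word_mult (word_inv w) w = []"
proof (induction w)
  case (Cons l w)
  have "word_mult (word_inv (l # w)) (l # w) = word_mult (word_inv w) (push (inv_letter l) (l # w))"
    by (simp add: word_mult_def word_inv_def)
  then show ?case using Cons by simp
qed (simp add: word_mult_def word_inv_def)

typedef 'x fgroup = "{w :: 'x letter list. reduced w}"
  by (rule exI[of _ "[]"]) simp

setup_lifting type_definition_fgroup

lift_definition fgroup_mult :: "'x fgroup \<Rightarrow> 'x fgroup \<Rightarrow> 'x fgroup" is word_mult
  by (rule reduced_word_mult)

lift_definition fgroup_one :: "'x fgroup" is "[]" by simp

lift_definition fgroup_inv :: "'x fgroup \<Rightarrow> 'x fgroup" is word_inv by (rule reduced_word_inv)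

lift_definition fgroup_gen :: "'x \<Rightarrow> 'x fgroup" is "\<lambda>x. [(x, True)]" by simp

definition free_group :: "'x fgroup monoid" where
  "free_group = \<lparr>carrier = UNIV, mult = fgroup_mult, one = fgroup_one\<rparr>"

lemma carrier_free_group [simp]: "carrier free_group = UNIV"
  by (simp add: free_group_def)

lemma group_free_group: "group (free_group :: 'x fgroup monoid)"
proof (rule groupI)
  fix x y z :: "'x fgroup"
  show "x \<otimes>\<^bsub>free_group\<^esub> y \<otimes>\<^bsub>free_group\<^esub> z = x \<otimes>\<^bsub>free_group\<^esub> (y \<otimes>\<^bsub>free_group\<^esub> z)"
    unfolding free_group_def by simp (transfer, rule word_mult_assoc)
  show "\<one>\<^bsub>free_group\<^esub> \<otimes>\<^bsub>free_group\<^esub> x = x"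
    unfolding free_group_def by simp (transfer, simp add: word_mult_def)
  have "fgroup_mult (fgroup_inv x) x = fgroup_one"
    by transfer (rule word_inv_mult)
  then show "\<exists>y\<in>carrier free_group. y \<otimes>\<^bsub>free_group\<^esub> x = \<one>\<^bsub>free_group\<^esub>"
    unfolding free_group_def by auto
qed auto

datatype gen2 = A | B

type_synonym f2 = "gen2 fgroup"

abbreviation F2 :: "f2 monoid" where "F2 \<equiv> free_group"
abbreviation gen_a :: f2 where "gen_a \<equiv> fgroup_gen A"
abbreviation gen_b :: f2 where "gen_b \<equiv> fgroup_gen B"


section \<open>The Hilbert space of square-summable functions\<close>

definition square_summable :: "('g \<Rightarrow> complex) \<Rightarrow> bool" where
  "square_summable f \<longleftrightarrow> (\<lambda>x. (cmod (f x))\<^sup>2) summable_on UNIV"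

lemma square_summable_mult:
  assumes "square_summable f" "square_summable g"
  shows "(\<lambda>x. f x * cnj (g x)) summable_on UNIV"
proof -
  have "(\<lambda>x. (cmod (f x))\<^sup>2 + (cmod (g x))\<^sup>2) summable_on UNIV"
    using assms unfolding square_summable_def by (rule summable_on_add)
  then have "(\<lambda>x. norm (f x * cnj (g x))) summable_on UNIV"
  proof (rule summable_on_comparison_test)
    fix x
    have "2 * (cmod (f x) * cmod (g x)) \<le> (cmod (f x))\<^sup>2 + (cmod (g x))\<^sup>2"
      using sum_squares_bound[of "cmod (f x)" "cmod (g x)"] by simp
    moreover have "0 \<le> cmod (f x) * cmod (g x)" by simp
    ultimately have "cmod (f x) * cmod (g x) \<le> (cmod (f x))\<^sup>2 + (cmod (g x))\<^sup>2"
      by linarith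
    then show "cmod (f x * cnj (g x)) \<le> (cmod (f x))\<^sup>2 + (cmod (g x))\<^sup>2"
      by (simp add: norm_mult)
  qed simp
  then show ?thesis by (rule abs_summable_summable)
qed

lemma square_summable_scale:
  "square_summable f \<Longrightarrow> square_summable (\<lambda>x. c * f x)"
  unfolding square_summable_def
  by (simp add: norm_mult power_mult_distrib summable_on_cmult_right)

lemma square_summable_add:
  assumes "square_summable f" "square_summable g"
  shows "square_summable (\<lambda>x. f x + g x)"
proof -
  have "(\<lambda>x. 2 * (cmod (f x))\<^sup>2 + 2 * (cmod (g x))\<^sup>2) summable_on UNIV"
    using assms unfolding square_summable_def
    by (intro summable_on_add summable_on_cmult_right)
  then show ?thesis unfolding square_summable_def
  proof (rule summable_on_comparison_test)
    fix x
    have "(cmod (f x + g x))\<^sup>2 \<le> (cmod (f x) + cmod (g x))\<^sup>2"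
      by (intro power_mono norm_triangle_ineq) simp
    also have "\<dots> \<le> 2 * (cmod (f x))\<^sup>2 + 2 * (cmod (g x))\<^sup>2"
      using sum_squares_bound[of "cmod (f x)" "cmod (g x)"] by (simp add: power2_sum)
    finally show "(cmod (f x + g x))\<^sup>2 \<le> 2 * (cmod (f x))\<^sup>2 + 2 * (cmod (g x))\<^sup>2" .
  qed simp
qed

typedef 'g ell2 = "{f :: 'g \<Rightarrow> complex. square_summable f}"
  by (rule exI[of _ "\<lambda>_. 0"]) (simp add: square_summable_def)

setup_lifting type_definition_ell2

lift_definition scaleC :: "complex \<Rightarrow> 'g ell2 \<Rightarrow> 'g ell2" is "\<lambda>c f x. c * f x"
  by (rule square_summable_scale)

lift_definition cinner :: "'g ell2 \<Rightarrow> 'g ell2 \<Rightarrow> complex" is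
  "\<lambda>f g. \<Sum>\<^sub>\<infinity>x. f x * cnj (g x)" .

instantiation ell2 :: (type) real_vector
begin

lift_definition zero_ell2 :: "'a ell2" is "\<lambda>_. 0"
  by (simp add: square_summable_def)
lift_definition plus_ell2 :: "'a ell2 \<Rightarrow> 'a ell2 \<Rightarrow> 'a ell2" is "\<lambda>f g x. f x + g x"
  by (rule square_summable_add)
lift_definition uminus_ell2 :: "'a ell2 \<Rightarrow> 'a ell2" is "\<lambda>f x. - f x"
  by (simp add: square_summable_def)
definition minus_ell2 :: "'a ell2 \<Rightarrow> 'a ell2 \<Rightarrow> 'a ell2" where
  "minus_ell2 f g = f + - g"
definition scaleR_ell2 :: "real \<Rightarrow> 'a ell2 \<Rightarrow> 'a ell2" where
  "scaleR_ell2 r f = scaleC (of_real r) f"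

instance
  by standard
    (simp_all add: minus_ell2_def scaleR_ell2_def, (transfer, simp add: algebra_simps fun_eq_iff)+)

end

lemma minus_ell2_rep: "Rep_ell2 (f - g) x = Rep_ell2 f x - Rep_ell2 g x"
  unfolding minus_ell2_def plus_ell2.rep_eq uminus_ell2.rep_eq by simp

lemma cinner_add_left: "cinner (f + g) h = cinner f h + cinner g h"
  by transfer (simp add: distrib_right infsum_add square_summable_mult)

lemma cinner_add_right: "cinner f (g + h) = cinner f g + cinner f h"
  by transfer (simp add: distrib_left infsum_add square_summable_mult)

lemma cinner_scaleC_left: "cinner (scaleC c f) g = c * cinner f g"
  by transfer (simp add: mult.assoc infsum_cmult_right square_summable_mult)

lemma cinner_commute: "cinner g f = cnj (cinner f g)"
  by transfer (simp add: mult.commute flip: infsum_cnj)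

lemma cinner_scaleC_right: "cinner f (scaleC c g) = cnj c * cinner f g"
  by (metis cinner_commute cinner_scaleC_left complex_cnj_mult)

lemma cinner_self: "cinner f f = of_real (\<Sum>\<^sub>\<infinity>x. (cmod (Rep_ell2 f x))\<^sup>2)"
proof -
  have "cinner f f = (\<Sum>\<^sub>\<infinity>x. of_real ((cmod (Rep_ell2 f x))\<^sup>2))"
    by (simp only: cinner.rep_eq complex_norm_square)
  also have "\<dots> = of_real (\<Sum>\<^sub>\<infinity>x. (cmod (Rep_ell2 f x))\<^sup>2)"
    using Rep_ell2[of f] unfolding square_summable_def mem_Collect_eq
    by (intro infsumI has_sum_of_real has_sum_infsum)
  finally show ?thesis .
qed

instantiation ell2 :: (type) real_inner
begin

definition inner_ell2 :: "'a ell2 \<Rightarrow> 'a ell2 \<Rightarrow> real" where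
  "inner_ell2 f g = Re (cinner f g)"
definition norm_ell2 :: "'a ell2 \<Rightarrow> real" where
  "norm_ell2 f = sqrt (Re (cinner f f))"
definition dist_ell2 :: "'a ell2 \<Rightarrow> 'a ell2 \<Rightarrow> real" where
  "dist_ell2 f g = norm (f - g)"
definition sgn_ell2 :: "'a ell2 \<Rightarrow> 'a ell2" where
  "sgn_ell2 f = inverse (norm f) *\<^sub>R f"
definition uniformity_ell2 :: "('a ell2 \<times> 'a ell2) filter" where
  "uniformity_ell2 = (INF e\<in>{0<..}. principal {(x, y). dist x y < e})"
definition open_ell2 :: "'a ell2 set \<Rightarrow> bool" where
  "open_ell2 U = (\<forall>x\<in>U. \<forall>\<^sub>F (x', y) in uniformity. x' = x \<longrightarrow> y \<in> U)"

instance
proof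
  fix f g h :: "'a ell2" and r :: real
  have ss: "(\<lambda>x. (cmod (Rep_ell2 f x))\<^sup>2) summable_on UNIV"
    using Rep_ell2[of f] by (simp add: square_summable_def)
  show "inner f g = inner g f"
    unfolding inner_ell2_def by (subst cinner_commute) simp
  show "inner (f + g) h = inner f h + inner g h"
    by (simp add: inner_ell2_def cinner_add_left)
  show "inner (r *\<^sub>R f) g = r * inner f g"
    by (simp add: inner_ell2_def scaleR_ell2_def cinner_scaleC_left)
  show "0 \<le> inner f f"
    by (simp add: inner_ell2_def cinner_self infsum_nonneg)
  show "inner f f = 0 \<longleftrightarrow> f = 0"
  proof
    assume "inner f f = 0"
    then have "Rep_ell2 f x = 0" for x
      using nonneg_infsum_le_0D[OF _ ss, of x] by (simp add: inner_ell2_def cinner_self)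
    then show "f = 0"
      by (metis Rep_ell2_inject ext zero_ell2.rep_eq)
  qed (simp add: inner_ell2_def cinner.rep_eq zero_ell2.rep_eq)
  show "norm f = sqrt (inner f f)"
    by (simp add: norm_ell2_def inner_ell2_def)
qed (simp_all add: dist_ell2_def sgn_ell2_def uniformity_ell2_def open_ell2_def)

end

lemma norm_ell2_sq: "(norm f)\<^sup>2 = (\<Sum>\<^sub>\<infinity>x. (cmod (Rep_ell2 f x))\<^sup>2)"
  by (simp add: norm_ell2_def cinner_self infsum_nonneg)

definition delta :: "'g \<Rightarrow> 'g ell2" where
  "delta g = Abs_ell2 (\<lambda>x. if x = g then 1 else 0)"

lemma Rep_delta: "Rep_ell2 (delta g) = (\<lambda>x. if x = g then 1 else 0)"
proof -
  have "(\<lambda>x. (cmod (if x = g then 1 else 0))\<^sup>2) summable_on {g}"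
    by simp
  then have "(\<lambda>x. (cmod (if x = g then 1 else 0))\<^sup>2) summable_on UNIV"
    by (rule summable_on_cong_neutral[THEN iffD1, rotated -1]) auto
  then show ?thesis
    by (simp add: delta_def Abs_ell2_inverse square_summable_def)
qed


section \<open>Bounded operators\<close>

text \<open>Elements of \<^typ>\<open>'g ell2 \<Rightarrow>\<^sub>L 'g ell2\<close> are only real-linear; the algebra of bounded operators
  on the complex Hilbert space consists of the complex-linear ones. Composition is \<open>o\<^sub>L\<close>, and
  \<open>norm\<close> is the operator norm.\<close>

type_synonym 'g op = "'g ell2 \<Rightarrow>\<^sub>L 'g ell2"

definition bounded_ops :: "'g op set" where
  "bounded_ops = {T. \<forall>c f. blinfun_apply T (scaleC c f) = scaleC c (blinfun_apply T f)}"

definition adj :: "'g op \<Rightarrow> 'g op" where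
  "adj T = (THE S. \<forall>f g. cinner (blinfun_apply T f) g = cinner f (blinfun_apply S g))"

definition unitary_op :: "'g op \<Rightarrow> bool" where
  "unitary_op u \<longleftrightarrow> u \<in> bounded_ops \<and> adj u o\<^sub>L u = id_blinfun \<and> u o\<^sub>L adj u = id_blinfun"

definition commutant :: "'g op set \<Rightarrow> 'g op set" where
  "commutant S = {T \<in> bounded_ops. \<forall>s\<in>S. T o\<^sub>L s = s o\<^sub>L T}"


section \<open>Group von Neumann algebras\<close>

text \<open>A group \<open>G\<close> is assumed below to exhaust its type, i.e. \<open>carrier G = UNIV\<close>, so that
  \<^typ>\<open>'g ell2\<close> is the space of square-summable functions on \<open>G\<close>.\<close>

definition left_reg :: "('g, 'm) monoid_scheme \<Rightarrow> 'g \<Rightarrow> 'g op" where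
  "left_reg G g = Blinfun (\<lambda>f. Abs_ell2 (\<lambda>x. Rep_ell2 f (inv\<^bsub>G\<^esub> g \<otimes>\<^bsub>G\<^esub> x)))"

text \<open>The double commutant of \<open>\<lambda>(H)\<close>. Commutants are taken in all bounded operators on
  \<open>\<ell>\<^sup>2(G)\<close>, so for a subgroup \<open>H\<close> of \<open>G\<close> this is \<open>L(H)\<close> as a subalgebra of \<open>L(G)\<close>.\<close>

definition group_vN :: "('g, 'm) monoid_scheme \<Rightarrow> 'g set \<Rightarrow> 'g op set" where
  "group_vN G H = commutant (commutant (left_reg G ` H))"

definition vN_trace :: "('g, 'm) monoid_scheme \<Rightarrow> 'g op \<Rightarrow> complex" where
  "vN_trace G x = cinner (blinfun_apply x (delta \<one>\<^bsub>G\<^esub>)) (delta \<one>\<^bsub>G\<^esub>)"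

definition trace_norm2 :: "('g, 'm) monoid_scheme \<Rightarrow> 'g op \<Rightarrow> real" where
  "trace_norm2 G x = sqrt (Re (vN_trace G (adj x o\<^sub>L x)))"

definition conj_by :: "'g op \<Rightarrow> 'g op set \<Rightarrow> 'g op set" where
  "conj_by u P = (\<lambda>x. u o\<^sub>L x o\<^sub>L adj u) ` P"


section \<open>Distances between subalgebras\<close>

text \<open>Meaningful for nonempty sets that are bounded with respect to \<open>d\<close>, as the suprema and
  infima are real-valued.\<close>

definition hausdorff_dist :: "('a \<Rightarrow> 'a \<Rightarrow> real) \<Rightarrow> 'a set \<Rightarrow> 'a set \<Rightarrow> real" where
  "hausdorff_dist d X Y = max (SUP x\<in>X. INF y\<in>Y. d x y) (SUP y\<in>Y. INF x\<in>X. d x y)"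

definition op_ball :: "'g op set \<Rightarrow> 'g op set" where
  "op_ball P = {x \<in> P. norm x \<le> 1}"

definition d_KK :: "'g op set \<Rightarrow> 'g op set \<Rightarrow> real" where
  "d_KK P Q = hausdorff_dist (\<lambda>x y. norm (x - y)) (op_ball P) (op_ball Q)"

definition d_MT :: "('g, 'm) monoid_scheme \<Rightarrow> 'g op set \<Rightarrow> 'g op set \<Rightarrow> real" where
  "d_MT G P Q = hausdorff_dist (\<lambda>x y. trace_norm2 G (x - y)) (op_ball P) (op_ball Q)"


section \<open>Well-definedness\<close>

lemma delta_right: "cinner f (delta x) = Rep_ell2 f x"
proof -
  have "cinner f (delta x) = (\<Sum>\<^sub>\<infinity>y\<in>UNIV. Rep_ell2 f y * cnj (if y = x then 1 else 0))"
    by (simp add: cinner.rep_eq Rep_delta)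
  also have "\<dots> = (\<Sum>\<^sub>\<infinity>y\<in>{x}. Rep_ell2 f y)"
    by (rule infsum_cong_neutral) auto
  finally show ?thesis by simp
qed

lemma ell2_eqI: "(\<And>x. Rep_ell2 f x = Rep_ell2 g x) \<Longrightarrow> f = g"
  by (metis Rep_ell2_inject ext)

lemma left_reg_apply:
  fixes G (structure)
  assumes "group G" and UNIV: "carrier G = UNIV"
  shows "Rep_ell2 (blinfun_apply (left_reg G g) f) x = Rep_ell2 f (inv g \<otimes> x)"
    and "left_reg G g \<in> bounded_ops"
proof -
  interpret group G by fact
  have bij: "bij_betw (\<lambda>x. inv g \<otimes> x) UNIV UNIV"
    by (rule bij_betwI[of _ _ _ "\<lambda>x. g \<otimes> x"]) (auto simp: UNIV simp flip: m_assoc)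
  define T where "T f = Abs_ell2 (\<lambda>x. Rep_ell2 f (inv g \<otimes> x))" for f
  have Rep_T: "Rep_ell2 (T f) x = Rep_ell2 f (inv g \<otimes> x)" for f x
  proof -
    have "square_summable (\<lambda>x. Rep_ell2 f (inv g \<otimes> x))"
      using summable_on_reindex_bij_betw[OF bij, of "\<lambda>x. (cmod (Rep_ell2 f x))\<^sup>2"] Rep_ell2[of f]
      by (simp add: square_summable_def)
    then show ?thesis by (simp add: T_def Abs_ell2_inverse)
  qed
  have norm_T: "norm (T f) = norm f" for f
  proof -
    have "(norm (T f))\<^sup>2 = (norm f)\<^sup>2"
      using infsum_reindex_bij_betw[OF bij, of "\<lambda>x. (cmod (Rep_ell2 f x))\<^sup>2"]
      by (simp add: norm_ell2_sq Rep_T)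
    then show ?thesis by simp
  qed
  have "bounded_linear T"
    by (rule bounded_linear_intro[where K = 1])
      (auto intro!: ell2_eqI simp: Rep_T norm_T plus_ell2.rep_eq scaleR_ell2_def scaleC.rep_eq)
  then have ap: "blinfun_apply (left_reg G g) = T"
    unfolding left_reg_def T_def[abs_def, symmetric] by (rule bounded_linear_Blinfun_apply)
  show "Rep_ell2 (blinfun_apply (left_reg G g) f) x = Rep_ell2 f (inv g \<otimes> x)"
    by (simp add: ap Rep_T)
  show "left_reg G g \<in> bounded_ops"
    by (auto simp: bounded_ops_def ap intro!: ell2_eqI simp: Rep_T scaleC.rep_eq)
qed

lemma cinner_bound: "cmod (cinner f g) \<le> norm f * norm g"
proof (cases "cinner f g = 0")
  case False
  define c where "c = cnj (sgn (cinner f g))"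
  have c: "c * cinner f g = of_real (cmod (cinner f g))"
  proof -
    have "cinner f g * cnj (cinner f g) = (of_real (cmod (cinner f g)))\<^sup>2"
      using complex_norm_square[of "cinner f g"] by simp
    then show ?thesis
      using False by (simp add: c_def sgn_eq mult.commute power2_eq_square)
  qed
  have "cmod c = 1" using False by (simp add: c_def norm_sgn)
  then have "norm (scaleC c f) = norm f"
    by (simp add: norm_ell2_def cinner_self scaleC.rep_eq norm_mult)
  moreover have "cmod (cinner f g) = inner (scaleC c f) g"
    by (simp add: inner_ell2_def cinner_scaleC_left c)
  ultimately show ?thesis
    using norm_cauchy_schwarz[of "scaleC c f" g] by simp
qed simp

lemma ell2_has_sum: "((\<lambda>x. scaleC (Rep_ell2 f x) (delta x)) has_sum f) UNIV"
proof -
  let ?q = "\<lambda>x. (cmod (Rep_ell2 f x))\<^sup>2"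
  let ?s = "\<lambda>F. \<Sum>x\<in>F. scaleC (Rep_ell2 f x) (delta x)"
  have summ: "?q summable_on UNIV"
    using Rep_ell2[of f] by (simp add: square_summable_def)
  have Rep_s: "Rep_ell2 (?s F) y = (if y \<in> F then Rep_ell2 f y else 0)" if "finite F" for F y
    using that by (induction F)
      (auto simp: zero_ell2.rep_eq plus_ell2.rep_eq scaleC.rep_eq Rep_delta)
  have n: "(norm (?s F - f))\<^sup>2 = infsum ?q UNIV - sum ?q F" if F: "finite F" for F
  proof -
    have "(norm (?s F - f))\<^sup>2 = infsum ?q (UNIV - F)"
      unfolding norm_ell2_sq
      by (rule infsum_cong_neutral)
        (auto simp: minus_ell2_rep Rep_s F)
    also have "\<dots> = infsum ?q UNIV - infsum ?q F"
      using F by (intro infsum_Diff summ) auto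
    finally show ?thesis using F by simp
  qed
  have "(sum ?q \<longlongrightarrow> infsum ?q UNIV) (finite_subsets_at_top UNIV)"
    using has_sum_infsum[OF summ] by (simp add: has_sum_def)
  then have "((\<lambda>F. infsum ?q UNIV - sum ?q F) \<longlongrightarrow> infsum ?q UNIV - infsum ?q UNIV)
      (finite_subsets_at_top UNIV)"
    by (intro tendsto_diff tendsto_const)
  moreover have "\<forall>\<^sub>F F in finite_subsets_at_top UNIV.
      infsum ?q UNIV - sum ?q F = (norm (?s F - f))\<^sup>2"
    by (rule eventually_finite_subsets_at_top_weakI) (simp add: n)
  ultimately have "((\<lambda>F. (norm (?s F - f))\<^sup>2) \<longlongrightarrow> infsum ?q UNIV - infsum ?q UNIV)
      (finite_subsets_at_top UNIV)"
    by (rule Lim_transform_eventually)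
  then have "((\<lambda>F. (norm (?s F - f))\<^sup>2) \<longlongrightarrow> 0) (finite_subsets_at_top UNIV)"
    by simp
  then have "((\<lambda>F. sqrt ((norm (?s F - f))\<^sup>2)) \<longlongrightarrow> sqrt 0) (finite_subsets_at_top UNIV)"
    by (rule tendsto_real_sqrt)
  then show ?thesis
    unfolding has_sum_def Lim_null[of _ f] by (simp add: tendsto_norm_zero_iff)
qed

lemma adj_works:
  assumes T: "T \<in> bounded_ops"
  shows "cinner (blinfun_apply T f) g = cinner f (blinfun_apply (adj T) g)"
    and "adj T \<in> bounded_ops"
proof -
  define \<phi> where "\<phi> g x = cinner g (blinfun_apply T (delta x))" for g x
  have bl: "bounded_linear (\<lambda>h. cinner (blinfun_apply T h) g)" for g
  proof (rule bounded_linear_intro[where K = "norm T * norm g"])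
    fix h
    have "cmod (cinner (blinfun_apply T h) g) \<le> norm (blinfun_apply T h) * norm g"
      by (rule cinner_bound)
    also have "\<dots> \<le> (norm T * norm h) * norm g"
      by (intro mult_right_mono norm_blinfun) simp
    finally show "cmod (cinner (blinfun_apply T h) g) \<le> norm h * (norm T * norm g)"
      by (simp add: mult_ac)
  qed (simp_all add: blinfun.add_right cinner_add_left scaleR_ell2_def
      cinner_scaleC_left scaleR_conv_of_real T[unfolded bounded_ops_def, simplified])
  have T_delta: "cinner (blinfun_apply T (scaleC c (delta x))) g = c * cnj (\<phi> g x)" for c x g
    using T cinner_commute[of g "blinfun_apply T (delta x)"]
    by (simp add: bounded_ops_def cinner_scaleC_left \<phi>_def)
  have \<phi>_summable: "square_summable (\<phi> g)" for g
    unfolding square_summable_def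
  proof (rule nonneg_bdd_above_summable_on)
    show "bdd_above (sum (\<lambda>x. (cmod (\<phi> g x))\<^sup>2) ` {F. F \<subseteq> UNIV \<and> finite F})"
    proof (rule bdd_aboveI2)
      fix F :: "'a set" assume "F \<in> {F. F \<subseteq> UNIV \<and> finite F}"
      then have F: "finite F" by simp
      define h where "h = (\<Sum>x\<in>F. scaleC (\<phi> g x) (delta x))"
      define r where "r = (\<Sum>x\<in>F. (cmod (\<phi> g x))\<^sup>2)"
      have r: "r \<ge> 0" unfolding r_def by (simp add: sum_nonneg)
      have Rep_h: "Rep_ell2 h y = (if y \<in> F then \<phi> g y else 0)" for y
        unfolding h_def using F by (induction F)
          (auto simp: zero_ell2.rep_eq plus_ell2.rep_eq scaleC.rep_eq Rep_delta)
      have "(norm h)\<^sup>2 = infsum (\<lambda>x. (cmod (\<phi> g x))\<^sup>2) F"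
        unfolding norm_ell2_sq by (rule infsum_cong_neutral) (auto simp: Rep_h)
      then have norm_h: "(norm h)\<^sup>2 = r" using F by (simp add: r_def)
      have "cinner (blinfun_apply T h) g = (\<Sum>x\<in>F. \<phi> g x * cnj (\<phi> g x))"
        unfolding h_def linear_sum[OF bounded_linear.linear[OF bl]] T_delta ..
      also have "\<dots> = of_real r"
        by (simp only: r_def complex_norm_square of_real_sum)
      finally have "r = cmod (cinner (blinfun_apply T h) g)" using r by simp
      also have "\<dots> \<le> norm (blinfun_apply T h) * norm g" by (rule cinner_bound)
      also have "\<dots> \<le> (norm T * norm h) * norm g"
        by (intro mult_right_mono norm_blinfun) simp
      finally have "norm h * norm h \<le> norm h * (norm T * norm g)"
        using norm_h by (simp add: power2_eq_square mult_ac)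
      then have "norm h \<le> norm T * norm g"
        by (cases "norm h = 0") (auto simp: mult_le_cancel_left)
      then show "(\<Sum>x\<in>F. (cmod (\<phi> g x))\<^sup>2) \<le> (norm T * norm g)\<^sup>2"
        using norm_h by (metis norm_ge_zero power_mono r_def)
    qed
  qed simp
  define S where "S g = Abs_ell2 (\<phi> g)" for g
  have Rep_S: "Rep_ell2 (S g) = \<phi> g" for g
    by (simp add: S_def Abs_ell2_inverse \<phi>_summable)
  have TS: "cinner (blinfun_apply T f) g = cinner f (S g)" for f g
  proof -
    have "((\<lambda>x. Rep_ell2 f x * cnj (\<phi> g x)) has_sum cinner (blinfun_apply T f) g) UNIV"
      using has_sum_bounded_linear[OF bl ell2_has_sum, of f g] by (simp only: T_delta)
    then show ?thesis by (simp add: cinner.rep_eq Rep_S infsumI)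
  qed
  have "bounded_linear S"
  proof (rule bounded_linear_intro[where K = "norm T"])
    fix g
    have "norm (S g) * norm (S g) = cmod (cinner (S g) (S g))"
      unfolding power2_eq_square[symmetric] norm_ell2_sq by (simp add: cinner_self infsum_nonneg)
    also have "\<dots> \<le> norm (blinfun_apply T (S g)) * norm g"
      unfolding TS[symmetric] by (rule cinner_bound)
    also have "\<dots> \<le> (norm T * norm (S g)) * norm g"
      by (intro mult_right_mono norm_blinfun) simp
    finally have "norm (S g) * norm (S g) \<le> norm (S g) * (norm g * norm T)"
      by (simp add: mult_ac)
    then show "norm (S g) \<le> norm g * norm T"
      by (cases "norm (S g) = 0") (auto simp: mult_le_cancel_left)
  qed (auto intro!: ell2_eqI simp: Rep_S \<phi>_def plus_ell2.rep_eq scaleR_ell2_def scaleC.rep_eq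
      cinner_add_left cinner_scaleC_left)
  then have ap: "blinfun_apply (Blinfun S) = S" by (rule bounded_linear_Blinfun_apply)
  have adj: "adj T = Blinfun S"
    unfolding adj_def
  proof (rule the_equality)
    fix S' assume S': "\<forall>f g. cinner (blinfun_apply T f) g = cinner f (blinfun_apply S' g)"
    show "S' = Blinfun S"
    proof (intro blinfun_eqI ell2_eqI)
      fix g x
      have "cinner (delta x) (blinfun_apply S' g) = cinner (delta x) (S g)"
        using S' TS by metis
      then have "cnj (cinner (delta x) (blinfun_apply S' g)) = cnj (cinner (delta x) (S g))"
        by simp
      then show "Rep_ell2 (blinfun_apply S' g) x = Rep_ell2 (blinfun_apply (Blinfun S) g) x"
        by (simp add: ap delta_right flip: cinner_commute)
    qed
  qed (simp add: ap TS)
  show "cinner (blinfun_apply T f) g = cinner f (blinfun_apply (adj T) g)"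
    by (simp add: adj ap TS)
  show "adj T \<in> bounded_ops"
    by (auto simp: bounded_ops_def adj ap intro!: ell2_eqI
        simp: Rep_S \<phi>_def scaleC.rep_eq cinner_scaleC_left)
qed

end

theory Submission
  imports Defs
begin

text \<open>
  If \<open>u \<in> L(\<langle>b\<rangle>)\<close> is a unitary of trace zero, then freeness of \<open>a\<close> and \<open>b\<close> makes
  \<open>u L(\<langle>a\<rangle>) u\<^sup>*\<close> orthogonal to \<open>\<lambda>\<^sub>a\<close> for the inner product of the trace. By Pythagoras \<open>\<lambda>\<^sub>a\<close>
  then has \<open>\<tau>\<close>-distance at least \<open>1\<close> from that algebra, and so also operator-norm distance at
  least \<open>1\<close>. No point of either unit ball is farther than \<open>1\<close> from the other ball, because both
  contain \<open>0\<close>. Hence both distances are \<open>1\<close> for every such \<open>u\<close>.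

  The choice \<open>u = \<lambda>\<^sub>b\<close> has trace zero but conjugates \<open>L(\<langle>a\<rangle>)\<close> to \<open>L(\<langle>b a b\<^sup>-\<^sup>1\<rangle>)\<close>. It is enough to
  have two nonzero Fourier coefficients, at \<open>k \<noteq> k'\<close> in \<open>\<langle>b\<rangle>\<close>: the coefficient of
  \<open>u \<lambda>\<^sub>a u\<^sup>*\<close> at \<open>m a n\<^sup>-\<^sup>1\<close> is \<open>u(m)\<close> times the conjugate of \<open>u(n)\<close>, so if
  \<open>u L(\<langle>a\<rangle>) u\<^sup>* = L(H)\<close>, then \<open>H\<close> contains \<open>k a k\<^sup>-\<^sup>1\<close> and \<open>k a k'\<^sup>-\<^sup>1\<close>, hence \<open>k' k\<^sup>-\<^sup>1\<close>. As \<open>u\<close>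
  commutes with \<open>\<lambda>(k' k\<^sup>-\<^sup>1)\<close>, that operator would lie in \<open>L(\<langle>a\<rangle>)\<close>, although \<open>\<langle>a\<rangle>\<close> and \<open>\<langle>b\<rangle>\<close>
  meet only in the identity (\<open>conj_not_group_vN\<close>).

  Such a unitary is the Blaschke product \<open>z (z - r) / (1 - r z)\<close> evaluated at \<open>z = \<lambda>\<^sub>b\<close>. It has
  modulus \<open>1\<close> on the unit circle, and its power series \<open>- r z + (1 - r\<^sup>2) z\<^sup>2 + \<dots>\<close> gives the Fourier
  coefficients. A Laurent polynomial of modulus \<open>1\<close> on the circle is a monomial, so some infinite
  series is unavoidable; here it is a Neumann series, and its convergence is the reason for
  proving \<open>\<ell>\<^sup>2\<close> complete.

  Besides the infinite order of \<open>b\<close>, all that is used about the free group is that \<open>h k = k' a\<close>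
  with \<open>h \<in> \<langle>a\<rangle>\<close> and \<open>k, k' \<in> \<langle>b\<rangle>\<close> forces \<open>k = 1\<close>; the analytic argument is carried out for
  any pair of subgroups with this property (locale \<open>free_position\<close>).
\<close>

section \<open>Completeness of the space of square-summable functions\<close>

lemma norm_delta [simp]: "norm (delta g) = 1"
  by (simp add: norm_ell2_def delta_right) (simp add: Rep_delta)

lemma coordinate_le_norm: "cmod (Rep_ell2 f x) \<le> norm f"
  using cinner_bound[of f "delta x"] by (simp add: delta_right)

lemma Rep_scaleR_ell2: "Rep_ell2 (c *\<^sub>R f) x = of_real c * Rep_ell2 f x"
  by (simp add: scaleR_ell2_def scaleC.rep_eq)

lemma bounded_linear_coordinate: "bounded_linear (\<lambda>f. Rep_ell2 f x)"
  by (rule bounded_linear_intro[where K = 1])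
    (auto simp: plus_ell2.rep_eq Rep_scaleR_ell2 scaleR_conv_of_real coordinate_le_norm)

lemma cinner_diff_left: "cinner (f - g) h = cinner f h - cinner g h"
  using cinner_add_left[of "f - g" g h] by simp

lemma cinner_diff_right: "cinner f (g - h) = cinner f g - cinner f h"
  using cinner_add_right[of f "g - h" h] by simp

lemma cinner_scaleR_left: "cinner (c *\<^sub>R f) g = of_real c * cinner f g"
  by (simp add: scaleR_ell2_def cinner_scaleC_left)

lemma cinner_scaleR_right: "cinner f (c *\<^sub>R g) = of_real c * cinner f g"
  by (simp add: scaleR_ell2_def cinner_scaleC_right)

lemma ell2_eqI_cinner:
  assumes "\<And>h. cinner h f = cinner h g" shows "f = g"
proof (rule ell2_eqI)
  fix x
  have "cinner f (delta x) = cinner g (delta x)"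
    using assms[of "delta x"] by (metis cinner_commute)
  then show "Rep_ell2 f x = Rep_ell2 g x" by (simp add: delta_right)
qed

text \<open>Every finite partial sum of \<open>\<bar>l\<bar>\<^sup>2\<close> is a limit of partial sums bounded by \<open>C\<^sup>2\<close>. This is what
  completeness needs twice: it puts the pointwise limit of a Cauchy sequence into \<open>\<ell>\<^sup>2\<close>, and it
  bounds the distance of a term from the limit by its distances from later terms.\<close>

lemma ell2_fatou:
  assumes lim: "\<And>x. (\<lambda>n. Rep_ell2 (f n) x) \<longlonglongrightarrow> l x"
    and bound: "\<forall>\<^sub>F n in sequentially. norm (f n) \<le> C"
  obtains g where "Rep_ell2 g = l" "norm g \<le> C"
proof -
  have C: "0 \<le> C"
  proof -
    obtain n where "norm (f n) \<le> C"
      using eventually_happens[OF bound] by auto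
    then show ?thesis by (rule order_trans[OF norm_ge_zero])
  qed
  have part: "(\<Sum>x\<in>F. (cmod (l x))\<^sup>2) \<le> C\<^sup>2" if F: "finite F" for F
  proof (rule tendsto_upperbound)
    show "(\<lambda>n. \<Sum>x\<in>F. (cmod (Rep_ell2 (f n) x))\<^sup>2) \<longlonglongrightarrow> (\<Sum>x\<in>F. (cmod (l x))\<^sup>2)"
      by (intro tendsto_sum tendsto_power tendsto_norm lim)
    show "\<forall>\<^sub>F n in sequentially. (\<Sum>x\<in>F. (cmod (Rep_ell2 (f n) x))\<^sup>2) \<le> C\<^sup>2"
      using bound
    proof eventually_elim
      case (elim n)
      have "(\<Sum>x\<in>F. (cmod (Rep_ell2 (f n) x))\<^sup>2) \<le> (norm (f n))\<^sup>2"
        unfolding norm_ell2_sq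
        using Rep_ell2[of "f n"] F by (intro finite_sum_le_infsum) (auto simp: square_summable_def)
      also have "\<dots> \<le> C\<^sup>2" using elim by (intro power_mono) auto
      finally show ?case .
    qed
  qed simp
  have ss: "square_summable l"
    unfolding square_summable_def
    by (rule nonneg_bdd_above_summable_on) (auto intro!: bdd_aboveI2[where M = "C\<^sup>2"] part)
  define g where "g = Abs_ell2 l"
  have Rep_g: "Rep_ell2 g = l" unfolding g_def using ss by (simp add: Abs_ell2_inverse)
  have "(norm g)\<^sup>2 \<le> C\<^sup>2"
    unfolding norm_ell2_sq Rep_g
    using ss part by (intro infsum_le_finite_sums) (auto simp: square_summable_def)
  then have "norm g \<le> C" using C by (rule power2_le_imp_le)
  with Rep_g show ?thesis by (rule that)
qed

instance ell2 :: (type) banach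
proof
  fix X :: "nat \<Rightarrow> 'a ell2" assume X: "Cauchy X"
  define l where "l x = lim (\<lambda>n. Rep_ell2 (X n) x)" for x
  have lim: "(\<lambda>n. Rep_ell2 (X n) x) \<longlonglongrightarrow> l x" for x
    unfolding l_def
    using bounded_linear.Cauchy[OF bounded_linear_coordinate X]
    by (simp add: Cauchy_convergent_iff convergent_LIMSEQ_iff)
  obtain K where "\<And>n. norm (X n) \<le> K"
    using Cauchy_Bseq[OF X] by (auto simp: Bseq_def)
  then obtain g where g: "Rep_ell2 g = l"
    using ell2_fatou[OF lim, of K] by auto
  have "X \<longlonglongrightarrow> g"
  proof (rule LIMSEQ_I)
    fix e :: real assume "0 < e"
    then obtain N where N: "\<And>m n. m \<ge> N \<Longrightarrow> n \<ge> N \<Longrightarrow> norm (X m - X n) < e / 2"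
      using CauchyD[OF X, of "e / 2"] by auto
    have "norm (X m - g) < e" if m: "m \<ge> N" for m
    proof -
      have "(\<lambda>n. Rep_ell2 (X m - X n) x) \<longlonglongrightarrow> Rep_ell2 (X m) x - l x" for x
        unfolding minus_ell2_rep by (intro tendsto_intros lim)
      moreover have "\<forall>\<^sub>F n in sequentially. norm (X m - X n) \<le> e / 2"
        using eventually_ge_at_top[of N] by eventually_elim (use N[OF m] in \<open>auto intro: less_imp_le\<close>)
      ultimately obtain k where k: "Rep_ell2 k = (\<lambda>x. Rep_ell2 (X m) x - l x)" "norm k \<le> e / 2"
        by (rule ell2_fatou)
      have "k = X m - g" by (rule ell2_eqI) (simp add: k(1) minus_ell2_rep g)
      with k(2) \<open>0 < e\<close> show ?thesis by simp
    qed
    then show "\<exists>N. \<forall>m\<ge>N. norm (X m - g) < e" by auto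
  qed
  then show "convergent X" by (auto simp: convergent_def)
qed


section \<open>Bounded operators and commutants\<close>

lemma scaleC_add: "scaleC c (f + g) = scaleC c f + scaleC c g"
  by (rule ell2_eqI) (simp add: scaleC.rep_eq plus_ell2.rep_eq algebra_simps)

lemma scaleC_diff: "scaleC c (f - g) = scaleC c f - scaleC c g"
  by (rule ell2_eqI) (simp add: scaleC.rep_eq minus_ell2_rep algebra_simps)

lemma scaleC_scaleR: "scaleC c (r *\<^sub>R f) = r *\<^sub>R scaleC c f"
  by (rule ell2_eqI) (simp add: scaleC.rep_eq Rep_scaleR_ell2)

lemma norm_scaleC: "norm (scaleC c f) = cmod c * norm f"
proof -
  have "(norm (scaleC c f))\<^sup>2 = (cmod c * norm f)\<^sup>2"
    unfolding norm_ell2_sq power_mult_distrib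
    by (simp add: scaleC.rep_eq norm_mult power_mult_distrib infsum_cmult_right')
  then show ?thesis by (simp add: power2_eq_iff_nonneg)
qed

lemma bounded_linear_scaleC: "bounded_linear (scaleC c)"
  by (rule bounded_linear_intro[where K = "cmod c"])
    (simp_all add: scaleC_add scaleC_scaleR norm_scaleC)

lemma blinfun_compose_assoc: "(S o\<^sub>L T) o\<^sub>L U = S o\<^sub>L (T o\<^sub>L U)"
  by (rule blinfun_eqI) simp

lemma blinfun_compose_id [simp]: "id_blinfun o\<^sub>L T = T" "T o\<^sub>L id_blinfun = T"
  by (auto intro: blinfun_eqI)

lemma bounded_opsD: "T \<in> bounded_ops \<Longrightarrow> blinfun_apply T (scaleC c f) = scaleC c (blinfun_apply T f)"
  by (simp add: bounded_ops_def)

lemma bounded_ops_diff: "S \<in> bounded_ops \<Longrightarrow> T \<in> bounded_ops \<Longrightarrow> S - T \<in> bounded_ops"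
  by (simp add: bounded_ops_def blinfun.diff_left scaleC_diff)

lemma bounded_ops_scaleR: "T \<in> bounded_ops \<Longrightarrow> r *\<^sub>R T \<in> bounded_ops"
  by (simp add: bounded_ops_def blinfun.scaleR_left scaleC_scaleR)

lemma bounded_ops_compose: "S \<in> bounded_ops \<Longrightarrow> T \<in> bounded_ops \<Longrightarrow> S o\<^sub>L T \<in> bounded_ops"
  by (simp add: bounded_ops_def)

lemma bounded_ops_suminf:
  assumes "summable X" "\<And>n. X n \<in> bounded_ops"
  shows "suminf X \<in> bounded_ops"
proof -
  have app: "blinfun_apply (suminf X) f = (\<Sum>n. blinfun_apply (X n) f)"
    and summ: "summable (\<lambda>n. blinfun_apply (X n) f)" for f
    using bounded_linear.suminf[OF blinfun.bounded_linear_left assms(1), of f]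
      bounded_linear.summable[OF blinfun.bounded_linear_left assms(1), of f] by simp_all
  show ?thesis
    unfolding bounded_ops_def
    by (simp add: app bounded_opsD[OF assms(2)] bounded_linear.suminf[OF bounded_linear_scaleC summ])
qed

lemmas bounded_linear_compose_left =
  bounded_bilinear.bounded_linear_right[OF bounded_bilinear_blinfun_compose]
lemmas bounded_linear_compose_right =
  bounded_bilinear.bounded_linear_left[OF bounded_bilinear_blinfun_compose]

lemma commutant_bounded: "T \<in> commutant S \<Longrightarrow> T \<in> bounded_ops"
  by (simp add: commutant_def)

lemma commutant_diff: "T \<in> commutant S \<Longrightarrow> T' \<in> commutant S \<Longrightarrow> T - T' \<in> commutant S"
  by (auto simp: commutant_def bounded_ops_diff
      linear_diff[OF bounded_linear.linear[OF bounded_linear_compose_left]]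
      linear_diff[OF bounded_linear.linear[OF bounded_linear_compose_right]])

lemma commutant_scaleR: "T \<in> commutant S \<Longrightarrow> r *\<^sub>R T \<in> commutant S"
  by (auto simp: commutant_def bounded_ops_scaleR
      linear_scale[OF bounded_linear.linear[OF bounded_linear_compose_left]]
      linear_scale[OF bounded_linear.linear[OF bounded_linear_compose_right]])

lemma commutant_compose: "T \<in> commutant S \<Longrightarrow> T' \<in> commutant S \<Longrightarrow> T o\<^sub>L T' \<in> commutant S"
  by (auto simp: commutant_def bounded_ops_compose blinfun_compose_assoc)
    (metis blinfun_compose_assoc)

lemma commutant_suminf:
  assumes "summable X" "\<And>n. X n \<in> commutant S"
  shows "suminf X \<in> commutant S"
  using assms(2)
  by (auto simp: commutant_def bounded_ops_suminf[OF assms(1)]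
      bounded_linear.suminf[OF bounded_linear_compose_left assms(1)]
      bounded_linear.suminf[OF bounded_linear_compose_right assms(1)])

lemma subset_double_commutant: "S \<subseteq> bounded_ops \<Longrightarrow> S \<subseteq> commutant (commutant S)"
  by (auto simp: commutant_def)

text \<open>Both kinds of operators used below to test the elements of \<open>L(H)\<close> have this form: right
  translations (\<open>m = 1\<close>, \<open>\<pi>\<close> a translation) and coordinate projections (\<open>m\<close> an indicator,
  \<open>\<pi> = id\<close>).\<close>

lemma weighted_composition_op:
  fixes m :: "'g \<Rightarrow> complex" and \<pi> :: "'g \<Rightarrow> 'g"
  assumes "inj \<pi>" and m: "\<And>x. cmod (m x) \<le> 1"
  obtains T where "T \<in> bounded_ops"
    and "\<And>f x. Rep_ell2 (blinfun_apply T f) x = m x * Rep_ell2 f (\<pi> x)"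
proof -
  let ?q = "\<lambda>f x. (cmod (Rep_ell2 f x))\<^sup>2"
  have q: "?q f summable_on UNIV" for f :: "'g ell2"
    using Rep_ell2[of f] by (simp add: square_summable_def)
  have q\<pi>: "(?q f \<circ> \<pi>) summable_on UNIV" for f :: "'g ell2"
    using summable_on_subset_banach[OF q, of "range \<pi>" f] summable_on_reindex[OF assms(1)] by blast
  have le: "(cmod (m x * Rep_ell2 f (\<pi> x)))\<^sup>2 \<le> (?q f \<circ> \<pi>) x" for f x
    using mult_right_mono[OF power_le_one[OF norm_ge_zero m[of x], of 2], of "?q f (\<pi> x)"]
    by (simp add: norm_mult power_mult_distrib)
  have s: "(\<lambda>x. (cmod (m x * Rep_ell2 f (\<pi> x)))\<^sup>2) summable_on UNIV" for f
    by (rule summable_on_comparison_test[OF q\<pi> le]) simp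
  define T where "T f = Abs_ell2 (\<lambda>x. m x * Rep_ell2 f (\<pi> x))" for f
  have Rep_T: "Rep_ell2 (T f) x = m x * Rep_ell2 f (\<pi> x)" for f x
    using s[of f] by (simp add: T_def Abs_ell2_inverse square_summable_def)
  have norm_T: "norm (T f) \<le> norm f" for f
  proof -
    have "(norm (T f))\<^sup>2 \<le> infsum (?q f \<circ> \<pi>) UNIV"
      unfolding norm_ell2_sq Rep_T by (rule infsum_mono[OF s q\<pi> le])
    also have "\<dots> = infsum (?q f) (range \<pi>)"
      by (rule infsum_reindex[OF assms(1), symmetric])
    also have "\<dots> \<le> infsum (?q f) UNIV"
      by (rule infsum_mono_neutral) (auto intro: q summable_on_subset_banach[OF q])
    finally show ?thesis
      unfolding norm_ell2_sq[symmetric] by (rule power2_le_imp_le) simp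
  qed
  have "bounded_linear T"
    by (rule bounded_linear_intro[where K = 1])
      (auto intro!: ell2_eqI simp: Rep_T norm_T plus_ell2.rep_eq Rep_scaleR_ell2 algebra_simps)
  then have ap: "blinfun_apply (Blinfun T) = T" by (rule bounded_linear_Blinfun_apply)
  show ?thesis
    by (rule that[of "Blinfun T"])
      (auto simp: ap Rep_T bounded_ops_def scaleC.rep_eq intro!: ell2_eqI)
qed

lemma Rep_adj:
  assumes "T \<in> bounded_ops"
  shows "Rep_ell2 (blinfun_apply (adj T) f) x = cnj (cinner (blinfun_apply T (delta x)) f)"
  using adj_works(1)[OF assms, of "delta x" f]
  by (metis cinner_commute delta_right)

lemma cinner_adj_left:
  "T \<in> bounded_ops \<Longrightarrow> cinner (blinfun_apply (adj T) f) g = cinner f (blinfun_apply T g)"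
  by (metis adj_works(1) cinner_commute)

text \<open>An isometry satisfies \<open>u\<^sup>* u = 1\<close>; a right inverse must then equal \<open>u\<^sup>*\<close>.\<close>

lemma unitary_opI:
  assumes u: "u \<in> bounded_ops"
    and iso: "\<And>f g. cinner (blinfun_apply u f) (blinfun_apply u g) = cinner f g"
    and R: "u o\<^sub>L R = id_blinfun"
  shows "unitary_op u"
proof -
  have 1: "adj u o\<^sub>L u = id_blinfun"
    by (intro blinfun_eqI ell2_eqI_cinner) (simp add: adj_works(1)[OF u, symmetric] iso)
  have "adj u = adj u o\<^sub>L (u o\<^sub>L R)" by (simp add: R)
  also have "\<dots> = R" by (simp add: blinfun_compose_assoc[symmetric] 1)
  finally show ?thesis using u 1 R by (simp add: unitary_op_def)
qed


section \<open>Fourier coefficients in the von Neumann algebra of a discrete group\<close>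

lemma vN_bounded: "T \<in> group_vN G H \<Longrightarrow> T \<in> bounded_ops"
  by (simp add: group_vN_def commutant_bounded)

lemma vN_commutes:
  assumes "T \<in> group_vN G H" "S \<in> bounded_ops"
    and "\<And>h. h \<in> H \<Longrightarrow> S o\<^sub>L left_reg G h = left_reg G h o\<^sub>L S"
  shows "T o\<^sub>L S = S o\<^sub>L T"
  using assms by (auto simp: group_vN_def commutant_def)

locale discrete_group = group G for G :: "('g, 'm) monoid_scheme" (structure) +
  assumes UNIV: "carrier G = UNIV"
begin

lemma in_carrier [simp]: "x \<in> carrier G"
  by (simp add: UNIV)

lemmas Rep_left_reg = left_reg_apply(1)[OF is_group UNIV]
lemmas left_reg_bounded = left_reg_apply(2)[OF is_group UNIV]

lemma eq_inv_mult_iff: "inv g \<otimes> x = y \<longleftrightarrow> x = g \<otimes> y"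
  by (metis in_carrier inv_solve_left)

lemma left_reg_delta: "blinfun_apply (left_reg G g) (delta h) = delta (g \<otimes> h)"
  by (rule ell2_eqI) (simp add: Rep_left_reg Rep_delta eq_inv_mult_iff)

lemma left_reg_mult: "left_reg G g o\<^sub>L left_reg G h = left_reg G (g \<otimes> h)"
  by (intro blinfun_eqI ell2_eqI) (simp add: Rep_left_reg inv_mult_group m_assoc)

lemma left_reg_one: "left_reg G \<one> = id_blinfun"
  by (intro blinfun_eqI ell2_eqI) (simp add: Rep_left_reg)

lemma cinner_left_reg:
  "cinner (blinfun_apply (left_reg G g) f) (blinfun_apply (left_reg G g) h) = cinner f h"
proof -
  have "bij_betw (\<lambda>x. inv g \<otimes> x) UNIV UNIV"
    by (rule bij_betwI[of _ _ _ "\<lambda>x. g \<otimes> x"]) (auto simp flip: m_assoc)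
  from infsum_reindex_bij_betw[OF this, of "\<lambda>x. Rep_ell2 f x * cnj (Rep_ell2 h x)"]
  show ?thesis by (simp add: cinner.rep_eq Rep_left_reg)
qed

lemma norm_left_reg_le: "norm (left_reg G g) \<le> 1"
  by (rule norm_blinfun_bound) (simp_all add: norm_ell2_def cinner_left_reg)

lemma left_reg_in_vN: "g \<in> H \<Longrightarrow> left_reg G g \<in> group_vN G H"
  unfolding group_vN_def using left_reg_bounded by (intro subsetD[OF subset_double_commutant]) auto

text \<open>For \<open>T = \<Sum>\<^sub>g c\<^sub>g \<lambda>\<^sub>g\<close> in \<open>L(G)\<close> this is the coefficient \<open>c\<^sub>g\<close>; its value at \<open>\<one>\<close> is the trace.\<close>

abbreviation fourier :: "'g op \<Rightarrow> 'g \<Rightarrow> complex" where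
  "fourier T g \<equiv> Rep_ell2 (blinfun_apply T (delta \<one>)) g"

text \<open>Right translations commute with the left regular representation, hence with \<open>T\<close>, and the one
  by \<open>x\<close> carries \<open>\<delta>\<^sub>1\<close> to \<open>\<delta>\<^sub>x\<close>: so \<open>T\<close> is determined by its Fourier coefficients.\<close>

lemma vN_matrix:
  assumes "T \<in> group_vN G H"
  shows "Rep_ell2 (blinfun_apply T (delta x)) y = fourier T (y \<otimes> inv x)"
proof -
  have inj: "inj (\<lambda>y. y \<otimes> inv x)" by (simp add: inj_def)
  obtain R where R: "R \<in> bounded_ops"
    "\<And>f y. Rep_ell2 (blinfun_apply R f) y = 1 * Rep_ell2 f (y \<otimes> inv x)"
    by (rule weighted_composition_op[OF inj, of "\<lambda>_. 1"]) auto
  have "blinfun_apply R (delta \<one>) = delta x"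
    by (rule ell2_eqI) (simp add: R(2) Rep_delta, metis in_carrier inv_solve_right l_one r_inv)
  moreover have "T o\<^sub>L R = R o\<^sub>L T"
    by (rule vN_commutes[OF assms R(1)])
      (intro blinfun_eqI ell2_eqI, simp add: R(2) Rep_left_reg m_assoc)
  then have "blinfun_apply T (blinfun_apply R (delta \<one>)) = blinfun_apply R (blinfun_apply T (delta \<one>))"
    by (metis blinfun_apply_blinfun_compose)
  ultimately show ?thesis by (simp add: R(2))
qed

text \<open>The projection onto the functions supported in a left \<open>H\<close>-invariant set \<open>S\<close> commutes with
  \<open>\<lambda>(H)\<close>, hence with all of \<open>L(H)\<close>.\<close>

lemma vN_support_invariant:
  assumes T: "T \<in> group_vN G H"
    and S: "\<And>h x. h \<in> H \<Longrightarrow> h \<otimes> x \<in> S \<longleftrightarrow> x \<in> S"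
    and f: "\<And>x. x \<notin> S \<Longrightarrow> Rep_ell2 f x = 0"
    and "x \<notin> S"
  shows "Rep_ell2 (blinfun_apply T f) x = 0"
proof -
  obtain P where P: "P \<in> bounded_ops"
    "\<And>f x. Rep_ell2 (blinfun_apply P f) x = indicator S x * Rep_ell2 f (id x)"
    by (rule weighted_composition_op[of id "indicator S"]) (auto split: split_indicator)
  have "T o\<^sub>L P = P o\<^sub>L T"
  proof (rule vN_commutes[OF T P(1)], intro blinfun_eqI ell2_eqI)
    fix h f x assume "h \<in> H"
    then have "inv h \<otimes> x \<in> S \<longleftrightarrow> x \<in> S"
      using S[of h "inv h \<otimes> x"] by (simp flip: m_assoc)
    then show "Rep_ell2 (blinfun_apply (P o\<^sub>L left_reg G h) f) x
        = Rep_ell2 (blinfun_apply (left_reg G h o\<^sub>L P) f) x"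
      by (simp add: P(2) Rep_left_reg indicator_def)
  qed
  then have "blinfun_apply T (blinfun_apply P f) = blinfun_apply P (blinfun_apply T f)"
    by (metis blinfun_apply_blinfun_compose)
  moreover have "blinfun_apply P f = f"
    by (rule ell2_eqI) (use f in \<open>auto simp: P(2) indicator_def\<close>)
  ultimately show ?thesis using \<open>x \<notin> S\<close> by (metis P(2) indicator_simps(2) mult_zero_left)
qed

lemma fourier_support:
  assumes "T \<in> group_vN G H" "subgroup H G" "x \<notin> H"
  shows "fourier T x = 0"
proof (rule vN_support_invariant[OF assms(1) _ _ assms(3)])
  interpret H: subgroup H G by fact
  show "h \<otimes> x \<in> H \<longleftrightarrow> x \<in> H" if "h \<in> H" for h x
    using that by (metis H.m_closed H.m_inv_closed eq_inv_mult_iff)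
  show "Rep_ell2 (delta \<one>) x = 0" if "x \<notin> H" for x
    using that H.one_closed by (auto simp: Rep_delta)
qed

lemma Rep_adj_delta:
  assumes "T \<in> group_vN G H"
  shows "Rep_ell2 (blinfun_apply (adj T) (delta y)) x = cnj (fourier T (y \<otimes> inv x))"
  unfolding Rep_adj[OF vN_bounded[OF assms]] delta_right vN_matrix[OF assms, of x y] ..

lemma fourier_conj:
  assumes "u \<in> bounded_ops"
  shows "fourier (u o\<^sub>L x o\<^sub>L adj u) g
    = cinner (blinfun_apply x (blinfun_apply (adj u) (delta \<one>))) (blinfun_apply (adj u) (delta g))"
  by (simp add: adj_works(1)[OF assms, symmetric] delta_right)

lemma trace_norm2_eq:
  assumes "T \<in> bounded_ops"
  shows "trace_norm2 G T = norm (blinfun_apply T (delta \<one>))"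
  by (simp add: trace_norm2_def vN_trace_def norm_ell2_def cinner_adj_left[OF assms])

end


section \<open>A Blaschke product of a group element\<close>

context discrete_group
begin

text \<open>The Neumann series of \<open>(1 - r \<lambda>\<^sub>g)\<^sup>-\<^sup>1\<close>.\<close>

definition geometric :: "real \<Rightarrow> 'g \<Rightarrow> 'g op" where
  "geometric r g = (\<Sum>n. r ^ n *\<^sub>R left_reg G (g [^] n))"

context
  fixes r :: real
  assumes r: "\<bar>r\<bar> < 1"
begin

lemma summable_geometric_left_reg: "summable (\<lambda>n. r ^ n *\<^sub>R left_reg G (g [^] (n::nat)))"
proof (rule summable_comparison_test)
  show "summable (\<lambda>n. \<bar>r\<bar> ^ n)" using r by (simp add: summable_geometric)
  show "\<exists>N. \<forall>n\<ge>N. norm (r ^ n *\<^sub>R left_reg G (g [^] n)) \<le> \<bar>r\<bar> ^ n"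
    using mult_left_mono[OF norm_left_reg_le, of "\<bar>r\<bar> ^ n" for n]
    by (auto simp: power_abs)
qed

lemma geometric_split:
  "geometric r g = id_blinfun + r *\<^sub>R (\<Sum>n. r ^ n *\<^sub>R left_reg G (g [^] Suc n))"
proof -
  have summ: "summable (\<lambda>n. r ^ n *\<^sub>R left_reg G (g [^] Suc n))"
    using bounded_linear.summable[OF bounded_linear_compose_right[of "left_reg G g"]
        summable_geometric_left_reg[of g]]
    by (simp add: linear_scale[OF bounded_linear.linear[OF bounded_linear_compose_right]] left_reg_mult)
  have "geometric r g = (\<Sum>n. r ^ Suc n *\<^sub>R left_reg G (g [^] Suc n)) + r ^ 0 *\<^sub>R left_reg G (g [^] (0::nat))"
    unfolding geometric_def suminf_split_head[OF summable_geometric_left_reg] by simp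
  also have "(\<Sum>n. r ^ Suc n *\<^sub>R left_reg G (g [^] Suc n)) = r *\<^sub>R (\<Sum>n. r ^ n *\<^sub>R left_reg G (g [^] Suc n))"
    by (subst suminf_scaleR_right[OF summ]) (simp del: nat_pow_Suc)
  finally show ?thesis by (simp add: left_reg_one)
qed

lemma geometric_left: "geometric r g = id_blinfun + r *\<^sub>R (left_reg G g o\<^sub>L geometric r g)"
proof -
  have "g \<otimes> g [^] n = g [^] Suc n" for n :: nat
    by (metis nat_pow_Suc2 in_carrier)
  then have "left_reg G g o\<^sub>L geometric r g = (\<Sum>n. r ^ n *\<^sub>R left_reg G (g [^] Suc n))"
    using bounded_linear.suminf[OF bounded_linear_compose_left[of "left_reg G g"]
        summable_geometric_left_reg[of g]]
    by (simp add: linear_scale[OF bounded_linear.linear[OF bounded_linear_compose_left]]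
        left_reg_mult geometric_def del: nat_pow_Suc)
  then show ?thesis by (simp only: geometric_split[of g])
qed

lemma geometric_right: "geometric r g = id_blinfun + r *\<^sub>R (geometric r g o\<^sub>L left_reg G g)"
  using bounded_linear.suminf[OF bounded_linear_compose_right[of "left_reg G g"]
      summable_geometric_left_reg[of g]] geometric_split[of g]
  by (simp add: linear_scale[OF bounded_linear.linear[OF bounded_linear_compose_right]]
      left_reg_mult geometric_def)

lemma geometric_in_vN:
  assumes "\<And>n::nat. g [^] n \<in> H" shows "geometric r g \<in> group_vN G H"
  unfolding geometric_def group_vN_def
  by (intro commutant_suminf summable_geometric_left_reg commutant_scaleR
      left_reg_in_vN[OF assms, unfolded group_vN_def])

lemma fourier_geometric_sums:
  "(\<lambda>n. of_real (r ^ n) * (if x = g [^] n then 1 else 0)) sums fourier (geometric r g) x"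
proof -
  have bl: "bounded_linear (\<lambda>T :: 'g op. fourier T x)"
    by (rule bounded_linear_compose[OF bounded_linear_coordinate blinfun.bounded_linear_left])
  show ?thesis
    using bounded_linear.sums[OF bl summable_sums[OF summable_geometric_left_reg[of g]]]
    by (simp add: geometric_def blinfun.scaleR_left Rep_scaleR_ell2 left_reg_delta Rep_delta)
qed

lemma fourier_geometric_power:
  assumes "\<And>m n :: nat. g [^] m = g [^] n \<longleftrightarrow> m = n"
  shows "fourier (geometric r g) (g [^] (k::nat)) = of_real (r ^ k)"
proof (rule sums_unique2[OF fourier_geometric_sums])
  show "(\<lambda>n. of_real (r ^ n) * (if g [^] k = g [^] n then 1 else 0)) sums complex_of_real (r ^ k)"
    using sums_single[of k "\<lambda>n. complex_of_real (r ^ n)"]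
    by (simp add: assms if_distrib eq_commute[of k] cong: if_cong)
qed

lemma fourier_geometric_nonpower:
  assumes "\<And>n :: nat. x \<noteq> g [^] n"
  shows "fourier (geometric r g) x = 0"
  using sums_unique2[OF fourier_geometric_sums[of x g]] sums_zero by (simp add: assms)

text \<open>The Blaschke product \<open>z (z - r) / (1 - r z)\<close> evaluated at \<open>z = \<lambda>\<^sub>g\<close>. The factor \<open>z\<close> makes the
  trace vanish.\<close>

definition blaschke :: "'g \<Rightarrow> 'g op" where
  "blaschke g = (left_reg G (g \<otimes> g) - r *\<^sub>R left_reg G g) o\<^sub>L geometric r g"

lemma blaschke_in_vN:
  assumes "subgroup H G" "g \<in> H" shows "blaschke g \<in> group_vN G H"
proof -
  interpret H: subgroup H G by fact
  have pow: "g [^] n \<in> H" for n :: nat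
    by (induction n) (auto intro: H.m_closed assms)
  show ?thesis
    unfolding blaschke_def
    using left_reg_in_vN[of "g \<otimes> g" H] left_reg_in_vN[of g H] geometric_in_vN[OF pow] assms(2)
    unfolding group_vN_def by (intro commutant_compose commutant_diff commutant_scaleR) auto
qed

text \<open>Write \<open>V = \<lambda>\<^sub>g\<close> and \<open>W = (1 - r V)\<^sup>-\<^sup>1\<close>. On the circle \<open>\<bar>z - r\<bar> = \<bar>1 - r z\<bar>\<close>; correspondingly the
  inner product of \<open>(V - r) p\<close> and \<open>(V - r) q\<close> is that of \<open>(1 - r V) p\<close> and \<open>(1 - r V) q\<close>, since
  \<open>V\<close> is an isometry. Taking \<open>p = W f\<close> and \<open>q = W h\<close> shows that the Blaschke product is isometric. It
  is onto because \<open>V - r = V (1 - r V\<^sup>-\<^sup>1)\<close>, whose last factor is inverted by the Neumann series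
  of \<open>g\<^sup>-\<^sup>1\<close>.\<close>

lemma unitary_blaschke: "unitary_op (blaschke g)"
proof (rule unitary_opI)
  show "blaschke g \<in> bounded_ops"
    using blaschke_in_vN[OF subgroup_self, of g] by (simp add: vN_bounded)
  let ?V = "\<lambda>f. blinfun_apply (left_reg G g) f" and ?W = "\<lambda>f. blinfun_apply (geometric r g) f"
  have W: "?W f = f + r *\<^sub>R ?V (?W f)" for f
    using arg_cong[OF geometric_left[of g], of "\<lambda>T. blinfun_apply T f"]
    by (simp add: blinfun.add_left blinfun.scaleR_left)
  have u: "blinfun_apply (blaschke g) f = ?V (?V (?W f) - r *\<^sub>R ?W f)" for f
    unfolding blaschke_def left_reg_mult[symmetric]
    by (simp add: blinfun.diff_left blinfun.diff_right blinfun.scaleR_left blinfun.scaleR_right)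
  fix f h
  have f: "f = ?W f - r *\<^sub>R ?V (?W f)" and h: "h = ?W h - r *\<^sub>R ?V (?W h)"
    by (metis W add_diff_cancel_right')+
  have "cinner (blinfun_apply (blaschke g) f) (blinfun_apply (blaschke g) h)
      = cinner (?W f - r *\<^sub>R ?V (?W f)) (?W h - r *\<^sub>R ?V (?W h))"
    unfolding u cinner_left_reg
    by (simp add: cinner_diff_left cinner_diff_right cinner_scaleR_left cinner_scaleR_right
        cinner_left_reg algebra_simps)
  then show "cinner (blinfun_apply (blaschke g) f) (blinfun_apply (blaschke g) h) = cinner f h"
    by (metis f h)
next
  let ?V = "\<lambda>f. blinfun_apply (left_reg G g) f" and ?W = "\<lambda>f. blinfun_apply (geometric r g) f"
  let ?V' = "\<lambda>f. blinfun_apply (left_reg G (inv g)) f"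
    and ?W' = "\<lambda>f. blinfun_apply (geometric r (inv g)) f"
  have VV': "?V (?V' f) = f" for f
    by (rule ell2_eqI) (simp add: Rep_left_reg flip: m_assoc)
  have WV: "?W (f - r *\<^sub>R ?V f) = f" for f
    using arg_cong[OF geometric_right[of g], of "\<lambda>T. blinfun_apply T f"]
    by (simp add: blinfun.add_left blinfun.scaleR_left blinfun.diff_right blinfun.scaleR_right)
  have W': "?W' f - r *\<^sub>R ?V' (?W' f) = f" for f
    using arg_cong[OF geometric_left[of "inv g"], of "\<lambda>T. blinfun_apply T f"]
    by (simp add: blinfun.add_left blinfun.scaleR_left) (metis add_diff_cancel_right')
  have u: "blinfun_apply (blaschke g) f = ?V (?V (?W f - r *\<^sub>R ?V' (?W f)))" for f
    unfolding blaschke_def left_reg_mult[symmetric]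
    by (simp add: blinfun.diff_left blinfun.diff_right blinfun.scaleR_left blinfun.scaleR_right VV')
  let ?R = "(id_blinfun - r *\<^sub>R left_reg G g) o\<^sub>L geometric r (inv g)
      o\<^sub>L left_reg G (inv g) o\<^sub>L left_reg G (inv g)"
  show "blaschke g o\<^sub>L ?R = id_blinfun"
    by (rule blinfun_eqI) (simp add: u WV W' VV' blinfun.diff_left blinfun.scaleR_left)
qed

lemma fourier_blaschke:
  "fourier (blaschke g) x = fourier (geometric r g) (inv (g \<otimes> g) \<otimes> x)
    - of_real r * fourier (geometric r g) (inv g \<otimes> x)"
  by (simp add: blaschke_def blinfun.diff_left blinfun.scaleR_left minus_ell2_rep
      Rep_scaleR_ell2 Rep_left_reg)

text \<open>The coefficients of \<open>z (z - r) (1 + r z + r\<^sup>2 z\<^sup>2 + \<dots>)\<close> at \<open>1\<close>, \<open>z\<close> and \<open>z\<^sup>2\<close>.\<close>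

lemma fourier_blaschke_values:
  assumes inf: "\<And>m n :: nat. g [^] m = g [^] n \<longleftrightarrow> m = n"
  shows "fourier (blaschke g) \<one> = 0"
    and "fourier (blaschke g) g = - of_real r"
    and "fourier (blaschke g) (g \<otimes> g) = 1 - of_real (r\<^sup>2)"
proof -
  have pos: "g [^] Suc n \<noteq> \<one>" for n
    using inf[of "Suc n" 0] by (simp del: nat_pow_Suc)
  have neg1: "inv g \<noteq> g [^] n" for n :: nat
    using pos[of n] by (metis in_carrier l_inv nat_pow_Suc2 r_inv nat_pow_Suc)
  have neg2: "inv (g \<otimes> g) \<noteq> g [^] n" for n :: nat
    using pos[of "Suc n"] by (metis in_carrier r_inv nat_pow_Suc2 m_assoc)
  note nonpow = fourier_geometric_nonpower[OF neg1] fourier_geometric_nonpower[OF neg2]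
  have w0: "fourier (geometric r g) \<one> = 1"
    using fourier_geometric_power[OF inf, of 0] by simp
  have w1: "fourier (geometric r g) g = of_real r"
    using fourier_geometric_power[OF inf, of 1] by simp
  have c: "inv (g \<otimes> g) \<otimes> g = inv g" "inv g \<otimes> (g \<otimes> g) = g"
    by (simp_all add: inv_mult_group m_assoc) (simp flip: m_assoc)
  show "fourier (blaschke g) \<one> = 0" by (simp add: fourier_blaschke nonpow)
  show "fourier (blaschke g) g = - of_real r" by (simp add: fourier_blaschke nonpow c w0)
  show "fourier (blaschke g) (g \<otimes> g) = 1 - of_real (r\<^sup>2)"
    by (simp add: fourier_blaschke nonpow c w0 w1 power2_eq_square)
qed

end

end


section \<open>Conjugating by a unitary of trace zero\<close>

text \<open>The common point \<open>z\<close> bounds both one-sided distances by \<open>1\<close>; the point \<open>a\<close> attains this bound.\<close>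

lemma hausdorff_dist_eq_1:
  assumes X: "z \<in> X" "\<And>x. x \<in> X \<Longrightarrow> d x z \<le> 1"
    and Y: "z \<in> Y" "\<And>y. y \<in> Y \<Longrightarrow> d z y \<le> 1"
    and nonneg: "\<And>x y. x \<in> X \<Longrightarrow> y \<in> Y \<Longrightarrow> 0 \<le> d x y"
    and far: "a \<in> X" "\<And>y. y \<in> Y \<Longrightarrow> 1 \<le> d a y"
  shows "hausdorff_dist d X Y = (1 :: real)"
proof -
  have bdd: "x \<in> X \<Longrightarrow> bdd_below ((\<lambda>y. d x y) ` Y)" "y \<in> Y \<Longrightarrow> bdd_below ((\<lambda>x. d x y) ` X)"
    for x y
    by (auto intro!: bdd_belowI2[where m = 0] nonneg)
  have le1: "(INF y\<in>Y. d x y) \<le> 1" if "x \<in> X" for x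
    using X(2)[OF that] by (rule cINF_lower2[OF bdd(1)[OF that] Y(1)])
  have le2: "(INF x\<in>X. d x y) \<le> 1" if "y \<in> Y" for y
    using Y(2)[OF that] by (rule cINF_lower2[OF bdd(2)[OF that] X(1)])
  have bdd_sup: "bdd_above ((\<lambda>x. INF y\<in>Y. d x y) ` X)"
    by (rule bdd_aboveI2[OF le1])
  have "1 \<le> (INF y\<in>Y. d a y)"
    using Y(1) far(2) by (intro cINF_greatest) auto
  then have "1 \<le> (SUP x\<in>X. INF y\<in>Y. d x y)"
    using cSUP_upper2[OF bdd_sup far(1)] by blast
  moreover have "(SUP x\<in>X. INF y\<in>Y. d x y) \<le> 1"
    using X(1) by (intro cSUP_least le1) auto
  moreover have "(SUP y\<in>Y. INF x\<in>X. d x y) \<le> 1"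
    using Y(1) by (intro cSUP_least le2) auto
  ultimately show ?thesis by (simp add: hausdorff_dist_def)
qed

text \<open>A weak form of freeness of \<open>A\<close> and \<open>B\<close> relative to one element \<open>a\<close> of \<open>A\<close>: the set of products
  \<open>A (B - {\<one>})\<close> does not meet the coset \<open>B a\<close>.\<close>

locale free_position = discrete_group G for G :: "('g, 'm) monoid_scheme" (structure) +
  fixes A B :: "'g set" and a :: 'g
  assumes A: "subgroup A G" and B: "subgroup B G" and a: "a \<in> A"
    and free: "\<lbrakk>h \<in> A; k \<in> B; k' \<in> B; h \<otimes> k = k' \<otimes> a\<rbrakk> \<Longrightarrow> k = \<one>"
begin

sublocale A: subgroup A G by (rule A)
sublocale B: subgroup B G by (rule B)

text \<open>The coefficient at \<open>a\<close> is the inner product of \<open>x u\<^sup>* \<delta>\<^sub>1\<close> and \<open>u\<^sup>* \<delta>\<^sub>a\<close>. The vector \<open>u\<^sup>* \<delta>\<^sub>1\<close> lives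
  on \<open>B - {\<one>}\<close>, because \<open>u\<close> has trace zero. So \<open>x u\<^sup>* \<delta>\<^sub>1\<close> lives on the left \<open>A\<close>-invariant set
  \<open>S = A (B - {\<one>})\<close>, whereas \<open>u\<^sup>* \<delta>\<^sub>a\<close> lives on \<open>B a\<close>, which is disjoint from \<open>S\<close>.\<close>

lemma fourier_conj_orthogonal:
  assumes x: "x \<in> group_vN G A" and u: "u \<in> group_vN G B" and "fourier u \<one> = 0"
  shows "fourier (u o\<^sub>L x o\<^sub>L adj u) a = 0"
proof -
  define S where "S = {h \<otimes> k | h k. h \<in> A \<and> k \<in> B \<and> k \<noteq> \<one>}"
  have S_iff: "h \<otimes> y \<in> S \<longleftrightarrow> y \<in> S" if h: "h \<in> A" for h y
  proof
    assume "h \<otimes> y \<in> S"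
    then obtain h' k where "h \<otimes> y = h' \<otimes> k" "h' \<in> A" "k \<in> B" "k \<noteq> \<one>"
      by (auto simp: S_def)
    moreover from this have "y = (inv h \<otimes> h') \<otimes> k"
      by (metis eq_inv_mult_iff in_carrier m_assoc)
    ultimately show "y \<in> S" using h by (auto simp: S_def)
  next
    assume "y \<in> S"
    then obtain h' k where "y = h' \<otimes> k" "h' \<in> A" "k \<in> B" "k \<noteq> \<one>"
      by (auto simp: S_def)
    moreover from this have "h \<otimes> y = (h \<otimes> h') \<otimes> k" by (simp add: m_assoc)
    ultimately show "h \<otimes> y \<in> S" using h unfolding S_def by blast
  qed
  have supp1: "Rep_ell2 (blinfun_apply (adj u) (delta \<one>)) y = 0" if y: "y \<notin> S" for y
  proof (rule ccontr)
    assume "\<not> ?thesis"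
    then have ne: "fourier u (inv y) \<noteq> 0" by (simp add: Rep_adj_delta[OF u])
    then have "inv y \<in> B" using fourier_support[OF u B] by blast
    then have "y \<in> B" using B.m_inv_closed by fastforce
    moreover have "y \<noteq> \<one>" using ne assms(3) by auto
    ultimately have "\<one> \<otimes> y \<in> S" unfolding S_def using A.one_closed by blast
    with y show False by simp
  qed
  have supp2: "Rep_ell2 (blinfun_apply (adj u) (delta a)) y = 0" if y: "y \<in> S" for y
  proof (rule ccontr)
    assume "\<not> ?thesis"
    then have "fourier u (a \<otimes> inv y) \<noteq> 0" by (simp add: Rep_adj_delta[OF u])
    then have B': "a \<otimes> inv y \<in> B" using fourier_support[OF u B] by blast
    obtain h k where hk: "y = h \<otimes> k" "h \<in> A" "k \<in> B" "k \<noteq> \<one>"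
      using y by (auto simp: S_def)
    have "y = inv (a \<otimes> inv y) \<otimes> a" by (simp add: inv_mult_group m_assoc)
    then have "h \<otimes> k = inv (a \<otimes> inv y) \<otimes> a" by (simp only: hk(1))
    from free[OF hk(2,3) B.m_inv_closed[OF B'] this] hk(4) show False by simp
  qed
  have "Rep_ell2 (blinfun_apply x (blinfun_apply (adj u) (delta \<one>))) y
      * cnj (Rep_ell2 (blinfun_apply (adj u) (delta a)) y) = 0" for y
    using vN_support_invariant[OF x S_iff supp1, of y] supp2[of y] by (cases "y \<in> S") auto
  then show ?thesis
    unfolding fourier_conj[OF vN_bounded[OF u]] cinner.rep_eq by (simp only: infsum_0)
qed

text \<open>Formally \<open>u \<lambda>\<^sub>a u\<^sup>*\<close> is the double series of the terms \<open>u(i) u(j)\<^sup>*\<close> at \<open>i a j\<^sup>-\<^sup>1\<close>, and the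
  \<open>i a j\<^sup>-\<^sup>1\<close> with \<open>i, j \<in> B\<close> are pairwise distinct: an equality \<open>i a j\<^sup>-\<^sup>1 = k a k'\<^sup>-\<^sup>1\<close> gives
  \<open>a (k'\<^sup>-\<^sup>1 j) = (k\<^sup>-\<^sup>1 i) a\<close>. In the proof, \<open>y\<close> runs over the group and stands for the pair
  \<open>j = y\<^sup>-\<^sup>1 a\<close>, \<open>i = k a k'\<^sup>-\<^sup>1 y\<^sup>-\<^sup>1\<close>.\<close>

lemma fourier_conj_left_reg:
  assumes u: "u \<in> group_vN G B" and k: "k \<in> B" "k' \<in> B"
  shows "fourier (u o\<^sub>L left_reg G a o\<^sub>L adj u) (k \<otimes> a \<otimes> inv k') = fourier u k * cnj (fourier u k')"
proof -
  let ?g = "k \<otimes> a \<otimes> inv k'" and ?y = "a \<otimes> inv k'"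
  let ?t = "\<lambda>y. cnj (fourier u (inv (inv a \<otimes> y))) * fourier u (?g \<otimes> inv y)"
  have t0: "?t y = 0" if "y \<noteq> ?y" for y
  proof (rule ccontr)
    let ?i = "?g \<otimes> inv y" and ?j = "inv (inv a \<otimes> y)"
    assume "?t y \<noteq> 0"
    then have j: "?j \<in> B" and i: "?i \<in> B"
      using fourier_support[OF u B] by fastforce+
    have "a \<otimes> (inv k' \<otimes> ?j) = (inv k \<otimes> ?i) \<otimes> a"
      by (simp add: inv_mult_group m_assoc) (simp flip: m_assoc)
    then have "inv k' \<otimes> ?j = \<one>"
      by (rule free[OF a B.m_closed[OF B.m_inv_closed j] B.m_closed[OF B.m_inv_closed i], rotated 2])
        (rule k)+
    then have "?j = k'" using eq_inv_mult_iff[of k' ?j \<one>] by simp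
    then have "inv a \<otimes> y = inv k'" by (metis inv_inv in_carrier)
    then have "y = ?y" by (simp only: eq_inv_mult_iff)
    with that show False by simp
  qed
  have "fourier (u o\<^sub>L left_reg G a o\<^sub>L adj u) ?g = (\<Sum>\<^sub>\<infinity>y. ?t y)"
    unfolding fourier_conj[OF vN_bounded[OF u]] cinner.rep_eq
    by (simp add: Rep_left_reg Rep_adj_delta[OF u])
  also have "\<dots> = (\<Sum>\<^sub>\<infinity>y\<in>{?y}. ?t y)"
    by (rule infsum_cong_neutral) (use t0 in auto)
  also have "\<dots> = fourier u k * cnj (fourier u k')"
  proof -
    have "inv (inv a \<otimes> ?y) = k'" "?g \<otimes> inv ?y = k"
      by (simp_all add: inv_mult_group m_assoc) (simp_all flip: m_assoc)
    then show ?thesis by simp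
  qed
  finally show ?thesis .
qed

lemma A_Int_B: "k \<in> A \<Longrightarrow> k \<in> B \<Longrightarrow> k = \<one>"
  using free[of "a \<otimes> inv k" k \<one>] a by (simp add: m_assoc)

text \<open>By the previous formula \<open>H\<close> contains \<open>k a k\<^sup>-\<^sup>1\<close> and \<open>k a k'\<^sup>-\<^sup>1\<close>, hence the element
  \<open>l = k' k\<^sup>-\<^sup>1\<close> of \<open>B\<close>. So \<open>\<lambda>\<^sub>l = u x u\<^sup>*\<close> with \<open>x \<in> L(A)\<close>; as \<open>B\<close> is commutative, \<open>\<lambda>\<^sub>l\<close>
  commutes with \<open>u\<close>, so that \<open>x = \<lambda>\<^sub>l\<close> and \<open>l \<in> A \<inter> B\<close>.\<close>

lemma conj_not_group_vN:
  assumes u: "u \<in> group_vN G B" "unitary_op u"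
    and comm: "\<And>h k. h \<in> B \<Longrightarrow> k \<in> B \<Longrightarrow> h \<otimes> k = k \<otimes> h"
    and k: "k \<in> B" "k' \<in> B" "k \<noteq> k'" "fourier u k \<noteq> 0" "fourier u k' \<noteq> 0"
    and H: "subgroup H G"
  shows "conj_by u (group_vN G A) \<noteq> group_vN G H"
proof
  assume eq: "conj_by u (group_vN G A) = group_vN G H"
  interpret H: subgroup H G by (rule H)
  have "u o\<^sub>L left_reg G a o\<^sub>L adj u \<in> group_vN G H"
    using left_reg_in_vN[OF a] by (auto simp: conj_by_def simp flip: eq)
  then have "k \<otimes> a \<otimes> inv k \<in> H" "k \<otimes> a \<otimes> inv k' \<in> H"
    using fourier_support[OF _ H] fourier_conj_left_reg[OF u(1)] k by fastforce+
  then have "inv (k \<otimes> a \<otimes> inv k') \<otimes> (k \<otimes> a \<otimes> inv k) \<in> H" by simp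
  also have "inv (k \<otimes> a \<otimes> inv k') \<otimes> (k \<otimes> a \<otimes> inv k) = k' \<otimes> inv k"
    by (simp add: inv_mult_group m_assoc) (simp flip: m_assoc)
  finally have "left_reg G (k' \<otimes> inv k) \<in> conj_by u (group_vN G A)"
    unfolding eq by (rule left_reg_in_vN)
  then obtain x where x: "x \<in> group_vN G A" "left_reg G (k' \<otimes> inv k) = u o\<^sub>L x o\<^sub>L adj u"
    by (auto simp: conj_by_def)
  have l: "k' \<otimes> inv k \<in> B" using k by simp
  have "u o\<^sub>L left_reg G (k' \<otimes> inv k) = left_reg G (k' \<otimes> inv k) o\<^sub>L u"
    by (rule vN_commutes[OF u(1) left_reg_bounded]) (simp add: left_reg_mult comm[OF l])
  have uu: "adj u o\<^sub>L u = id_blinfun" using u(2) by (simp add: unitary_op_def)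
  have "x = (adj u o\<^sub>L u) o\<^sub>L x o\<^sub>L (adj u o\<^sub>L u)" by (simp add: uu)
  also have "\<dots> = adj u o\<^sub>L left_reg G (k' \<otimes> inv k) o\<^sub>L u"
    by (simp add: x(2) blinfun_compose_assoc)
  also have "\<dots> = adj u o\<^sub>L (u o\<^sub>L left_reg G (k' \<otimes> inv k))"
    by (simp add: \<open>u o\<^sub>L _ = _\<close> blinfun_compose_assoc)
  also have "\<dots> = left_reg G (k' \<otimes> inv k)"
    by (simp add: uu flip: blinfun_compose_assoc)
  finally have "fourier (left_reg G (k' \<otimes> inv k)) (k' \<otimes> inv k) = 0 \<or> k' \<otimes> inv k \<in> A"
    using fourier_support[OF x(1) A] by metis
  then have "k' \<otimes> inv k \<in> A" by (simp add: left_reg_delta Rep_delta)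
  then have "k' \<otimes> inv k = \<one>" using A_Int_B l by blast
  then show False using k(3) by (metis in_carrier inv_equality inv_inv)
qed

text \<open>Every \<open>y\<close> in the conjugated algebra has coefficient \<open>0\<close> at \<open>a\<close>, so \<open>\<lambda>\<^sub>a - y\<close> has coefficient
  \<open>1\<close> there, which bounds \<open>\<parallel>(\<lambda>\<^sub>a - y) \<delta>\<^sub>1\<parallel>\<close>, the trace norm, and thereby the operator norm from
  below.\<close>

lemma
  assumes u: "u \<in> group_vN G B" "unitary_op u" and tr: "fourier u \<one> = 0"
  shows d_KK_conj: "d_KK (group_vN G A) (conj_by u (group_vN G A)) = 1"
    and d_MT_conj: "d_MT G (group_vN G A) (conj_by u (group_vN G A)) = 1"
proof -
  let ?X = "op_ball (group_vN G A)" and ?Y = "op_ball (conj_by u (group_vN G A))"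
  (* 0 is the difference of left_reg G a with itself. *)
  have zero: "0 \<in> group_vN G A"
    unfolding group_vN_def using commutant_diff[OF left_reg_in_vN[OF a, unfolded group_vN_def]]
      left_reg_in_vN[OF a, unfolded group_vN_def] by fastforce
  have X0: "0 \<in> ?X" by (simp add: op_ball_def zero)
  have "u o\<^sub>L 0 o\<^sub>L adj u = 0" by (rule blinfun_eqI) simp
  then have "0 \<in> conj_by u (group_vN G A)" unfolding conj_by_def using zero by force
  then have Y0: "0 \<in> ?Y" by (simp add: op_ball_def)
  have aX: "left_reg G a \<in> ?X"
    by (simp add: op_ball_def left_reg_in_vN a norm_left_reg_le)
  have bX: "x \<in> bounded_ops" if "x \<in> ?X" for x
    using that vN_bounded by (auto simp: op_ball_def)
  have bY: "y \<in> bounded_ops" if "y \<in> ?Y" for y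
  proof -
    from that obtain x where "x \<in> group_vN G A" "y = u o\<^sub>L x o\<^sub>L adj u"
      by (auto simp: op_ball_def conj_by_def)
    then show ?thesis
      using vN_bounded[OF u(1)] by (auto intro!: bounded_ops_compose adj_works(2) vN_bounded[of x])
  qed
  have le: "norm (blinfun_apply T (delta \<one>)) \<le> norm T" for T :: "'g op"
    using norm_blinfun[of T "delta \<one>"] by simp
  have far: "1 \<le> norm (blinfun_apply (left_reg G a - y) (delta \<one>))" if "y \<in> ?Y" for y
  proof -
    have "fourier y a = 0"
      using that fourier_conj_orthogonal[OF _ u(1) tr] by (auto simp: op_ball_def conj_by_def)
    then have "fourier (left_reg G a - y) a = 1"
      by (simp add: blinfun.diff_left minus_ell2_rep left_reg_delta Rep_delta)
    then show ?thesis by (metis coordinate_le_norm norm_one)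
  qed
  have tn: "trace_norm2 G T \<le> norm T" if "T \<in> bounded_ops" for T
    using le that by (simp add: trace_norm2_eq)
  show "d_KK (group_vN G A) (conj_by u (group_vN G A)) = 1"
    unfolding d_KK_def
    by (rule hausdorff_dist_eq_1[OF X0 _ Y0 _ _ aX])
      (auto simp: op_ball_def intro: order_trans[OF far le])
  show "d_MT G (group_vN G A) (conj_by u (group_vN G A)) = 1"
    unfolding d_MT_def
  proof (rule hausdorff_dist_eq_1[OF X0 _ Y0 _ _ aX])
    fix x assume x: "x \<in> ?X"
    then show "trace_norm2 G (x - 0) \<le> 1"
      using tn[OF bX[OF x]] by (simp add: op_ball_def)
  next
    fix y assume y: "y \<in> ?Y"
    show "trace_norm2 G (0 - y) \<le> 1"
      using y tn[OF bounded_ops_diff[OF bX[OF X0] bY[OF y]]] by (simp add: op_ball_def)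
    show "1 \<le> trace_norm2 G (left_reg G a - y)"
      using far[OF y] by (simp add: trace_norm2_eq bounded_ops_diff left_reg_bounded bY[OF y])
  next
    fix x y assume "x \<in> ?X" "y \<in> ?Y"
    then show "0 \<le> trace_norm2 G (x - y)"
      by (simp add: trace_norm2_eq bounded_ops_diff bX bY)
  qed
qed

end


section \<open>Powers of distinct generators of a free group\<close>

lemma word_mult_append: "reduced (v @ w) \<Longrightarrow> word_mult v w = v @ w"
proof (induction v)
  case (Cons l v)
  then show ?case
    using push_reduced_Cons[of l "v @ w"] reduced_ConsD[of l "v @ w"] by (simp add: word_mult_def)
qed (simp add: word_mult_def)

lemma set_push: "set (push l w) \<subseteq> insert l (set w)"
  by (cases w) auto

lemma set_word_mult: "set (word_mult v w) \<subseteq> set v \<union> set w"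
  unfolding word_mult_def by (induction v) (use set_push in fastforce)+

definition generators :: "'x fgroup \<Rightarrow> 'x set" where
  "generators g = fst ` set (Rep_fgroup g)"

lemma mult_free_group: "g \<otimes>\<^bsub>free_group\<^esub> h = fgroup_mult g h"
  and one_free_group: "\<one>\<^bsub>free_group\<^esub> = fgroup_one"
  by (simp_all add: free_group_def)

lemma inv_free_group: "inv\<^bsub>free_group\<^esub> g = fgroup_inv g"
proof (rule group.inv_equality[OF group_free_group])
  show "fgroup_inv g \<otimes>\<^bsub>free_group\<^esub> g = \<one>\<^bsub>free_group\<^esub>"
    unfolding mult_free_group one_free_group by transfer (rule word_inv_mult)
qed simp_all

lemma generators_generate:
  assumes "g \<in> generate free_group {fgroup_gen x}" shows "generators g \<subseteq> {x}"
  using assms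
proof induction
  case one
  then show ?case by (simp add: generators_def one_free_group fgroup_one.rep_eq)
next
  case (incl h)
  then show ?case by (simp add: generators_def fgroup_gen.rep_eq)
next
  case (inv h)
  then show ?case
    by (simp add: generators_def inv_free_group fgroup_inv.rep_eq fgroup_gen.rep_eq
        word_inv_def inv_letter_def)
next
  case (eng h k)
  then show ?case
    using set_word_mult[of "Rep_fgroup h" "Rep_fgroup k"]
    unfolding generators_def mult_free_group fgroup_mult.rep_eq by fastforce
qed

text \<open>Cancellation at the junction would need the same generator at the end of one word and at the
  start of the other.\<close>

lemma Rep_mult_disjoint:
  assumes "generators g \<inter> generators h = {}"
  shows "Rep_fgroup (g \<otimes>\<^bsub>free_group\<^esub> h) = Rep_fgroup g @ Rep_fgroup h"
proof -
  let ?v = "Rep_fgroup g" and ?w = "Rep_fgroup h"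
  have "hd ?w \<noteq> inv_letter (last ?v)" if "?v \<noteq> []" "?w \<noteq> []"
  proof
    assume "hd ?w = inv_letter (last ?v)"
    then have "fst (hd ?w) = fst (last ?v)" by (simp add: inv_letter_def)
    moreover have "fst (hd ?w) \<in> generators h" "fst (last ?v) \<in> generators g"
      using that by (auto simp: generators_def)
    ultimately show False using assms by auto
  qed
  then have "reduced (?v @ ?w)"
    using Rep_fgroup[of g] Rep_fgroup[of h] by (auto simp: reduced_def successively_append_iff)
  then show ?thesis
    by (simp add: mult_free_group fgroup_mult.rep_eq word_mult_append)
qed

text \<open>Otherwise the product word on the left ends in the generator \<open>y\<close>, while the one on the right
  ends in \<open>x\<close>.\<close>

lemma free_group_free_position:
  assumes "x \<noteq> y"
    and h: "h \<in> generate free_group {fgroup_gen x}"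
    and k: "k \<in> generate free_group {fgroup_gen y}" "k' \<in> generate free_group {fgroup_gen y}"
    and eq: "h \<otimes>\<^bsub>free_group\<^esub> k = k' \<otimes>\<^bsub>free_group\<^esub> fgroup_gen x"
  shows "k = \<one>\<^bsub>free_group\<^esub>"
proof (rule ccontr)
  assume "k \<noteq> \<one>\<^bsub>free_group\<^esub>"
  then have ne: "Rep_fgroup k \<noteq> []"
    by (metis Rep_fgroup_inject fgroup_one.rep_eq one_free_group)
  have gx: "generators (fgroup_gen x) = {x}" by (simp add: generators_def fgroup_gen.rep_eq)
  have "Rep_fgroup h @ Rep_fgroup k = Rep_fgroup k' @ [(x, True)]"
    using arg_cong[OF eq, of Rep_fgroup] generators_generate[OF h] generators_generate[OF k(1)]
      generators_generate[OF k(2)] gx \<open>x \<noteq> y\<close>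
    by (subst (asm) (1 2) Rep_mult_disjoint) (auto simp: fgroup_gen.rep_eq)
  then have "last (Rep_fgroup k) = (x, True)"
    using ne by (metis last_appendR last_snoc)
  then have "x \<in> generators k" using last_in_set[OF ne] by (force simp: generators_def)
  then show False using generators_generate[OF k(1)] \<open>x \<noteq> y\<close> by auto
qed

lemma Rep_gen_power: "Rep_fgroup (fgroup_gen x [^]\<^bsub>free_group\<^esub> n) = replicate n (x, True)"
proof (induction n)
  case 0
  then show ?case by (simp add: one_free_group fgroup_one.rep_eq)
next
  case (Suc n)
  have "reduced (replicate n (x, True) @ [(x, True)])"
    by (simp add: reduced_def inv_letter_def successively_conv_nth nth_append)
  then show ?case
    by (simp add: mult_free_group fgroup_mult.rep_eq Suc fgroup_gen.rep_eq word_mult_append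
        replicate_append_same)
qed

lemma gen_power_eq_iff:
  "fgroup_gen x [^]\<^bsub>free_group\<^esub> (m::nat) = fgroup_gen x [^]\<^bsub>free_group\<^esub> (n::nat) \<longleftrightarrow> m = n"
  by (metis Rep_gen_power length_replicate)

lemma (in group) generate_single_commute:
  assumes "g \<in> carrier G" "h \<in> generate G {g}" "k \<in> generate G {g}"
  shows "h \<otimes> k = k \<otimes> h"
  using assms generate_pow[OF assms(1)] by (auto simp: int_pow_mult[symmetric] add.commute)


section \<open>The subalgebras of the free group factor\<close>

theorem theorem5p19:
  "\<exists>u. u \<in> group_vN F2 (generate F2 {gen_b}) \<and> unitary_op u
     \<and> (\<forall>H. subgroup H F2 \<longrightarrow> conj_by u (group_vN F2 (generate F2 {gen_a})) \<noteq> group_vN F2 H)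
     \<and> d_KK (group_vN F2 (generate F2 {gen_a}))
             (conj_by u (group_vN F2 (generate F2 {gen_a}))) = 1
     \<and> d_MT F2 (group_vN F2 (generate F2 {gen_a}))
                (conj_by u (group_vN F2 (generate F2 {gen_a}))) = 1"
proof -
  interpret group F2 by (rule group_free_group)
  interpret free_position F2 "generate F2 {gen_a}" "generate F2 {gen_b}" gen_a
    by (intro free_position.intro discrete_group.intro is_group free_position_axioms.intro
        discrete_group_axioms.intro generate_is_subgroup carrier_free_group
        free_group_free_position[of A B])
      (auto intro: generate.incl)
  (* Any r with 0 < |r| < 1 would do. *)
  have r: "\<bar>1 / 2 :: real\<bar> < 1" by simp
  define u where "u = blaschke (1 / 2) gen_b"
  have b: "gen_b \<in> generate F2 {gen_b}" by (simp add: generate.incl)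
  have u: "u \<in> group_vN F2 (generate F2 {gen_b})" "unitary_op u"
    unfolding u_def by (rule blaschke_in_vN[OF r B b], rule unitary_blaschke[OF r])
  note val = fourier_blaschke_values[OF r gen_power_eq_iff, of B, folded u_def]
  have "gen_b \<noteq> gen_b \<otimes>\<^bsub>F2\<^esub> gen_b"
    using gen_power_eq_iff[of B 1 2] by (simp add: numeral_2_eq_2)
  moreover have "fourier u gen_b \<noteq> 0" "fourier u (gen_b \<otimes>\<^bsub>F2\<^esub> gen_b) \<noteq> 0"
    by (simp_all add: val power2_eq_square)
  moreover note comm = generate_single_commute[OF in_carrier[of gen_b]]
  ultimately have "conj_by u (group_vN F2 (generate F2 {gen_a})) \<noteq> group_vN F2 H"
    if "subgroup H F2" for H
    using conj_not_group_vN[OF u comm b B.m_closed[OF b b] _ _ _ that] by simp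
  then show ?thesis
    using u d_KK_conj[OF u val(1)] d_MT_conj[OF u val(1)] by blast
qed

end
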